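(* Let $\mathcal{X}$ be a finite set, $\mathcal{B}$ a finite-dimensional Hilbert space, and $x\mapsto\rho_x$ a classical-quantum channel with density matrices $\rho_x$ on $\mathcal{B}$. Let $p_X$ be a distribution on $\mathcal{X}$ and $\rho^{XB}=\sum_xp_X(x)|x\rangle\langle x|\otimes\rho_x$. For every rate $R<I(X:B)_\rho$ and every $\eta>0$ there exist $\delta\in(0,1/64)$ and a positive integer $n$ such that the following coding scheme over $n$ independent uses of the channel, with $M=\lfloor 2^{nR}\rfloor$ messages, has expected (over the random codebook) average decoding error probability at most $\eta$. Encoding: for each message $m\in\{1,\ldots,M\}$ choose a codeword $x^n(m)\in\mathcal{X}^n$ independently according to the i.i.d. distribution $p_X^{\otimes n}$; sending $m$ produces the state $\rho_{x^n(m)}$. Decoding: for $x^n\in T^{X^n}_\delta$ let $\Pi_{x^n}:=\Pi^{\rho_{x^n}}_\delta$ and for $x^n\notin T^{X^n}_\delta$ let $\Pi_{x^n}:=0$. On receiving a state, for $m=1,2,\ldots,M$ in turn, perform the two-outcome projective measurement $\{\Pi_{x^n(m)},I-\Pi_{x^n(m)}\}$ on the current (post-measurement) state; if the outcome is $\Pi_{x^n(m)}$, stop and output $m$, otherwise proceed to $m+1$; if all $M$ measurements fail, abort (counted as an error).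
   Context: Logarithms are base 2; $I(X:B)_\rho$ is the quantum mutual information of $\rho^{XB}$. $\rho_{x^n}:=\rho_{x_1}\otimes\cdots\otimes\rho_{x_n}$. Typical set: $T^{X^n}_\delta:=\{x^n:\forall x,\ |N(x|x^n)/n-p_X(x)|\le\delta p_X(x)\}$ with $N(x|x^n)$ the number of occurrences of $x$ in $x^n$. For a density matrix $\sigma=\sum_sq(s)|s\rangle\langle s|$ in a fixed eigenbasis, the typical projector $\Pi^{\sigma^n}_\delta$ projects onto the span of basis vectors $|s_1\cdots s_N\rangle$ with $|N(s|s^N)/N-q(s)|\le\delta q(s)$ for all $s$. The conditionally typical projector is $\Pi^{\rho_{x^n}}_\delta:=\bigotimes_{x\in\mathcal{X}}\Pi^{\rho_x^{\otimes N(x|x^n)}}_\delta$, where the factor for $x$ acts on the positions $i$ with $x_i=x$. The average error probability of a codebook is $M^{-1}\sum_m\Pr[\text{decoder output}\ne m\mid m\text{ sent}]$. *)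

theory Defs
  imports "HOL-Analysis.Analysis" "HOL-Computational_Algebra.Polynomial"
    "Jordan_Normal_Form.Char_Poly" "Jordan_Normal_Form.Schur_Decomposition"
begin

definition mtrace :: "complex mat \<Rightarrow> complex" where
  "mtrace A = (\<Sum>i<dim_row A. A $$ (i, i))"

definition outer :: "complex vec \<Rightarrow> complex mat" where
  "outer v = mat (dim_vec v) (dim_vec v) (\<lambda>(i, j). v $ i * cnj (v $ j))"

definition sum_matrix :: "nat \<Rightarrow> ('b \<Rightarrow> complex mat) \<Rightarrow> 'b set \<Rightarrow> complex mat" where
  "sum_matrix D f S = mat D D (\<lambda>ij. \<Sum>x\<in>S. f x $$ ij)"

definition tensor_vec :: "complex vec \<Rightarrow> complex vec \<Rightarrow> complex vec" where
  "tensor_vec u v = vec (dim_vec u * dim_vec v)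
     (\<lambda>i. u $ (i div dim_vec v) * v $ (i mod dim_vec v))"

definition tensor_mat :: "complex mat \<Rightarrow> complex mat \<Rightarrow> complex mat" where
  "tensor_mat A B = mat (dim_row A * dim_row B) (dim_col A * dim_col B)
     (\<lambda>(i, j). A $$ (i div dim_row B, j div dim_col B) * B $$ (i mod dim_row B, j mod dim_col B))"

definition tensor_vec_list :: "complex vec list \<Rightarrow> complex vec" where
  "tensor_vec_list vs = foldr tensor_vec vs (vec 1 (\<lambda>_. 1))"

definition tensor_mat_list :: "complex mat list \<Rightarrow> complex mat" where
  "tensor_mat_list As = foldr tensor_mat As (1\<^sub>m 1)"

definition ptrace_B :: "nat \<Rightarrow> nat \<Rightarrow> complex mat \<Rightarrow> complex mat" where
  "ptrace_B dA dB A = mat dA dA (\<lambda>(a, a'). \<Sum>b<dB. A $$ (a * dB + b, a' * dB + b))"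

definition ptrace_A :: "nat \<Rightarrow> nat \<Rightarrow> complex mat \<Rightarrow> complex mat" where
  "ptrace_A dA dB A = mat dB dB (\<lambda>(b, b'). \<Sum>a<dA. A $$ (a * dB + b, a * dB + b'))"

text \<open>von Neumann entropy (base 2): \<open>-\<Sum> \<lambda> log \<lambda>\<close> over the eigenvalues with multiplicity
  (roots of the characteristic polynomial); note \<open>0 * log 2 0 = 0\<close> in Isabelle.\<close>
definition vn_entropy :: "complex mat \<Rightarrow> real" where
  "vn_entropy A = - sum_mset (image_mset (\<lambda>z. Re z * log 2 (Re z)) (proots (char_poly A)))"

definition mutual_info :: "nat \<Rightarrow> nat \<Rightarrow> complex mat \<Rightarrow> real" where
  "mutual_info dA dB A = vn_entropy (ptrace_B dA dB A) + vn_entropy (ptrace_A dA dB A) - vn_entropy A"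

definition ket :: "nat \<Rightarrow> nat \<Rightarrow> complex vec" where
  "ket k x = vec k (\<lambda>i. if i = x then 1 else 0)"

definition cq_state :: "nat \<Rightarrow> nat \<Rightarrow> (nat \<Rightarrow> real) \<Rightarrow> (nat \<Rightarrow> complex mat) \<Rightarrow> complex mat" where
  "cq_state k d p \<rho> = sum_matrix (k * d) (\<lambda>x. complex_of_real (p x) \<cdot>\<^sub>m tensor_mat (outer (ket k x)) (\<rho> x)) {0..<k}"

definition seqs :: "nat \<Rightarrow> 'a set \<Rightarrow> 'a list set" where
  "seqs n A = {xs. length xs = n \<and> set xs \<subseteq> A}"

definition typical_set :: "nat \<Rightarrow> (nat \<Rightarrow> real) \<Rightarrow> real \<Rightarrow> nat \<Rightarrow> nat list set" where
  "typical_set k p \<delta> n = {xs \<in> seqs n {0..<k}.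
     \<forall>x<k. \<bar>real (count_list xs x) / real n - p x\<bar> \<le> \<delta> * p x}"

text \<open>Conditional typicality of the eigen-index sequence \<open>ss\<close> given \<open>xs\<close>: for every letter \<open>x\<close>,
  the subsequence of \<open>ss\<close> at the positions \<open>i\<close> with \<open>xs!i = x\<close> (of length \<open>N(x|xs)\<close>) is
  \<open>\<delta>\<close>-typical for the eigenvalue distribution \<open>q x\<close>; written with counts multiplied out
  (for \<open>N(x|xs) = 0\<close> the factor is the identity on the trivial space).\<close>
definition cond_typical :: "nat \<Rightarrow> nat \<Rightarrow> (nat \<Rightarrow> nat \<Rightarrow> real) \<Rightarrow> real \<Rightarrow> nat list \<Rightarrow> nat list \<Rightarrow> bool" where
  "cond_typical k d q \<delta> xs ss = (\<forall>x<k. \<forall>s<d.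
     \<bar>real (count_list (zip xs ss) (x, s)) - q x s * real (count_list xs x)\<bar>
       \<le> \<delta> * q x s * real (count_list xs x))"

text \<open>Conditionally typical projector \<open>\<Pi>^{\<rho>_{x^n}}_\<delta>\<close> in the fixed eigenbases \<open>e x s\<close> of \<open>\<rho>_x\<close>.\<close>
definition cond_typ_proj :: "nat \<Rightarrow> nat \<Rightarrow> (nat \<Rightarrow> nat \<Rightarrow> complex vec) \<Rightarrow> (nat \<Rightarrow> nat \<Rightarrow> real)
    \<Rightarrow> real \<Rightarrow> nat list \<Rightarrow> complex mat" where
  "cond_typ_proj k d e q \<delta> xs = sum_matrix (d ^ length xs)
     (\<lambda>ss. outer (tensor_vec_list (map2 e xs ss)))
     {ss \<in> seqs (length xs) {0..<d}. cond_typical k d q \<delta> xs ss}"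

definition dec_proj :: "nat \<Rightarrow> nat \<Rightarrow> (nat \<Rightarrow> real) \<Rightarrow> (nat \<Rightarrow> nat \<Rightarrow> complex vec) \<Rightarrow> (nat \<Rightarrow> nat \<Rightarrow> real)
    \<Rightarrow> real \<Rightarrow> nat list \<Rightarrow> complex mat" where
  "dec_proj k d p e q \<delta> xs =
     (if xs \<in> typical_set k p \<delta> (length xs) then cond_typ_proj k d e q \<delta> xs
      else 0\<^sub>m (d ^ length xs) (d ^ length xs))"

definition fail_op :: "nat \<Rightarrow> complex mat list \<Rightarrow> nat \<Rightarrow> complex mat" where
  "fail_op D Ps j = foldl (\<lambda>K P. (1\<^sub>m D - P) * K) (1\<^sub>m D) (take j Ps)"

definition seq_output_prob :: "nat \<Rightarrow> complex mat list \<Rightarrow> complex mat \<Rightarrow> nat \<Rightarrow> real" where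
  "seq_output_prob D Ps \<sigma> j =
     Re (mtrace (Ps ! j * fail_op D Ps j * \<sigma> * mat_adjoint (fail_op D Ps j) * mat_adjoint (Ps ! j)))"

definition avg_error :: "nat \<Rightarrow> nat \<Rightarrow> (nat \<Rightarrow> real) \<Rightarrow> (nat \<Rightarrow> complex mat) \<Rightarrow> (nat \<Rightarrow> nat \<Rightarrow> complex vec)
    \<Rightarrow> (nat \<Rightarrow> nat \<Rightarrow> real) \<Rightarrow> real \<Rightarrow> nat \<Rightarrow> nat list list \<Rightarrow> real" where
  "avg_error k d p \<rho> e q \<delta> n cb =
     (let M = length cb; Ps = map (dec_proj k d p e q \<delta>) cb in
      (\<Sum>m<M. 1 - seq_output_prob (d ^ n) Ps (tensor_mat_list (map \<rho> (cb ! m))) m) / real M)"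

definition expected_error :: "nat \<Rightarrow> nat \<Rightarrow> (nat \<Rightarrow> real) \<Rightarrow> (nat \<Rightarrow> complex mat) \<Rightarrow> (nat \<Rightarrow> nat \<Rightarrow> complex vec)
    \<Rightarrow> (nat \<Rightarrow> nat \<Rightarrow> real) \<Rightarrow> real \<Rightarrow> nat \<Rightarrow> nat \<Rightarrow> real" where
  "expected_error k d p \<rho> e q \<delta> n M =
     (\<Sum>cb \<in> seqs M (seqs n {0..<k}).
        (\<Prod>c\<leftarrow>cb. \<Prod>x\<leftarrow>c. p x) * avg_error k d p \<rho> e q \<delta> n cb)"

end

theory Submission
  imports Defs
begin

text \<open>
  Write the channel output for the word \<open>xs\<close> as a mixture of product eigenvectors \<open>v\<close>. For projections,
  the loss of squared norm along a sequence of measurements is at most four times the sum of the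
  losses caused by each projection separately (a non-commutative union bound, with no square root).
  It is applied not to \<open>v\<close> but to \<open>w = \<Pi> v\<close>, where \<open>\<Pi>\<close> is the typical projector of the average
  state; \<open>\<Pi>\<close> belongs to the analysis only, not to the decoder. Every term of the resulting bound is
  quadratic in \<open>v\<close>, so its expectation depends on the mixture alone and can be computed in an eigenbasis
  of the average state. The two terms \<open>|v - w|\<^sup>2\<close> and \<open>|v - \<Pi>\<^bsub>xs\<^esub> v|\<^sup>2\<close> average to at most probabilities
  of atypical sequences, which Chebyshev's inequality bounds by \<open>O(1/n)\<close>. A wrong codeword contributes the
  rank of its projector, at most \<open>2\<close> to the power \<open>n (1 + \<delta>)\<^sup>2 H(B|X)\<close>, times the largest typical
  eigenvalue of the average state, at most \<open>2\<close> to the power \<open>- n (1 - \<delta>) H(B)\<close>; with \<open>M\<close> at most \<open>2\<close> to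
  the power \<open>n R\<close> codewords this vanishes because \<open>R < H(B) - H(B|X)\<close>.
\<close>

section \<open>Independent letters and typical sequences\<close>

lemma seqs_0: "seqs 0 A = {[]}"
  by (auto simp: seqs_def)

lemma seqs_Suc: "seqs (Suc n) A = (\<lambda>(x, xs). x # xs) ` (A \<times> seqs n A)"
  by (force simp: seqs_def length_Suc_conv)

lemma finite_seqs: "finite A \<Longrightarrow> finite (seqs n A)"
  by (induction n) (auto simp: seqs_0 seqs_Suc)

lemma seqs_letter_less: "xs \<in> seqs n {0..<k} \<Longrightarrow> x \<in> set xs \<Longrightarrow> x < k"
  by (auto simp: seqs_def)

lemma bij_betw_Cons_seqs: "bij_betw (\<lambda>(x, xs). x # xs) (A \<times> seqs n A) (seqs (Suc n) A)"
  by (auto simp: bij_betw_def inj_on_def seqs_Suc)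

lemma sum_seqs_Suc:
  assumes "finite A"
  shows "(\<Sum>zs\<in>seqs (Suc n) A. F zs) = (\<Sum>z\<in>A. \<Sum>zs\<in>seqs n A. F (z # zs))"
  by (simp add: sum.cartesian_product case_prod_unfold flip: sum.reindex_bij_betw[OF bij_betw_Cons_seqs])

lemma zip_mem_seqs:
  assumes "xs \<in> seqs n A" "ys \<in> seqs n B"
  shows "zip xs ys \<in> seqs n (A \<times> B)"
  using assms by (auto simp: seqs_def dest: set_zip_leftD set_zip_rightD)

lemma map_fst_snd_mem_seqs:
  assumes "zs \<in> seqs n (A \<times> B)"
  shows "map fst zs \<in> seqs n A" "map snd zs \<in> seqs n B"
  using assms by (fastforce simp: seqs_def)+

lemma sum_seqs_zip:
  "(\<Sum>zs\<in>seqs n (A \<times> B). F zs) = (\<Sum>xs\<in>seqs n A. \<Sum>ys\<in>seqs n B. F (zip xs ys))"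
proof -
  have "(\<Sum>zs\<in>seqs n (A \<times> B). F zs) = (\<Sum>(xs, ys)\<in>seqs n A \<times> seqs n B. F (zip xs ys))"
    by (rule sum.reindex_bij_witness[where i = "\<lambda>(xs, ys). zip xs ys"
          and j = "\<lambda>zs. (map fst zs, map snd zs)"])
      (auto simp: map_fst_snd_mem_seqs zip_mem_seqs zip_map_fst_snd, auto simp: seqs_def)
  then show ?thesis by (simp add: sum.cartesian_product)
qed

definition distribution :: "'a set \<Rightarrow> ('a \<Rightarrow> real) \<Rightarrow> bool" where
  "distribution A P \<longleftrightarrow> finite A \<and> (\<forall>z\<in>A. 0 \<le> P z) \<and> sum P A = 1"

lemma distributionD:
  assumes "distribution A P"
  shows "finite A" "z \<in> A \<Longrightarrow> 0 \<le> P z" "sum P A = 1"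
  using assms by (auto simp: distribution_def)

lemma distribution_le_1:
  assumes "distribution A P" "z \<in> A"
  shows "P z \<le> 1"
  using member_le_sum[of z A P] assms by (auto simp: distribution_def)

definition indep_expect :: "'a set \<Rightarrow> ('a \<Rightarrow> real) list \<Rightarrow> ('a list \<Rightarrow> real) \<Rightarrow> real" where
  "indep_expect A Ps F = (\<Sum>zs\<in>seqs (length Ps) A. prod_list (map2 (\<lambda>P z. P z) Ps zs) * F zs)"

abbreviation iid_expect :: "nat \<Rightarrow> 'a set \<Rightarrow> ('a \<Rightarrow> real) \<Rightarrow> ('a list \<Rightarrow> real) \<Rightarrow> real" where
  "iid_expect n A P \<equiv> indep_expect A (replicate n P)"

lemma iid_expect_eq_sum: "iid_expect n A P F = (\<Sum>zs\<in>seqs n A. prod_list (map P zs) * F zs)"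
  unfolding indep_expect_def
  by (intro sum.cong) (simp_all add: zip_replicate1 seqs_def comp_def)

lemma indep_expect_map_eq_sum:
  "indep_expect A (map Q xs) F = (\<Sum>zs\<in>seqs (length xs) A. prod_list (map2 Q xs zs) * F zs)"
  by (simp add: indep_expect_def zip_map1 comp_def case_prod_unfold)

lemma indep_expect_Nil: "indep_expect A [] F = F []"
  by (simp add: indep_expect_def seqs_0)

lemma indep_expect_Cons:
  assumes "finite A"
  shows "indep_expect A (P # Ps) F = (\<Sum>z\<in>A. P z * indep_expect A Ps (\<lambda>zs. F (z # zs)))"
  by (simp add: indep_expect_def sum_seqs_Suc[OF assms] sum_distrib_left mult.assoc)

lemma indep_expect_add:
  "indep_expect A Ps (\<lambda>zs. F zs + G zs) = indep_expect A Ps F + indep_expect A Ps G"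
  by (simp add: indep_expect_def algebra_simps sum.distrib)

lemma indep_expect_diff:
  "indep_expect A Ps (\<lambda>zs. F zs - G zs) = indep_expect A Ps F - indep_expect A Ps G"
  by (simp add: indep_expect_def algebra_simps sum_subtractf)

lemma indep_expect_cmult: "indep_expect A Ps (\<lambda>zs. c * F zs) = c * indep_expect A Ps F"
  by (simp add: indep_expect_def sum_distrib_left mult_ac)

lemma indep_expect_sum:
  "indep_expect A Ps (\<lambda>zs. \<Sum>i\<in>I. F i zs) = (\<Sum>i\<in>I. indep_expect A Ps (F i))"
  unfolding indep_expect_def sum_distrib_left by (rule sum.swap)

lemma indep_expect_cong:
  "(\<And>zs. zs \<in> seqs (length Ps) A \<Longrightarrow> F zs = G zs) \<Longrightarrow> indep_expect A Ps F = indep_expect A Ps G"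
  by (simp add: indep_expect_def)

lemma indep_expect_mono:
  assumes "\<And>P. P \<in> set Ps \<Longrightarrow> distribution A P"
    and "\<And>zs. zs \<in> seqs (length Ps) A \<Longrightarrow> F zs \<le> G zs"
  shows "indep_expect A Ps F \<le> indep_expect A Ps G"
  unfolding indep_expect_def
proof (intro sum_mono mult_left_mono assms(2))
  fix zs assume zs: "zs \<in> seqs (length Ps) A"
  have "0 \<le> P z" if "(P, z) \<in> set (zip Ps zs)" for P z
    using assms(1)[OF set_zip_leftD[OF that]] set_zip_rightD[OF that] zs
    by (auto simp: seqs_def distribution_def)
  then show "0 \<le> prod_list (map2 (\<lambda>P z. P z) Ps zs)"
    by (intro prod_list_nonneg) auto
qed

lemma indep_expect_const:
  assumes "\<And>P. P \<in> set Ps \<Longrightarrow> distribution A P"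
  shows "indep_expect A Ps (\<lambda>_. c) = c"
  using assms
proof (induction Ps)
  case (Cons P Ps)
  then have "distribution A P" "indep_expect A Ps (\<lambda>_. c) = c" by simp_all
  then show ?case
    by (simp add: indep_expect_Cons distributionD flip: sum_distrib_right)
qed (simp add: indep_expect_Nil)

lemma indep_expect_nth:
  assumes "\<And>P. P \<in> set Ps \<Longrightarrow> distribution A P" "m < length Ps"
  shows "indep_expect A Ps (\<lambda>zs. F (zs ! m)) = (\<Sum>z\<in>A. (Ps ! m) z * F z)"
  using assms
proof (induction Ps arbitrary: m)
  case (Cons P Ps)
  have P: "distribution A P" and Ps: "\<And>Q. Q \<in> set Ps \<Longrightarrow> distribution A Q"
    using Cons.prems(1) by simp_all
  show ?case
  proof (cases m)
    case 0
    then show ?thesis by (simp add: indep_expect_Cons distributionD[OF P] indep_expect_const[OF Ps])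
  next
    case (Suc i)
    then have "indep_expect A Ps (\<lambda>zs. F (zs ! i)) = (\<Sum>z\<in>A. (Ps ! i) z * F z)"
      using Cons.IH[OF Ps] Cons.prems(2) by simp
    then show ?thesis
      using Suc by (simp add: indep_expect_Cons distributionD[OF P] flip: sum_distrib_right)
  qed
qed simp

lemma indep_expect_nth2:
  assumes "\<And>P. P \<in> set Ps \<Longrightarrow> distribution A P" "i < m" "m < length Ps"
  shows "indep_expect A Ps (\<lambda>zs. F (zs ! i) (zs ! m)) = (\<Sum>y\<in>A. (Ps ! i) y * (\<Sum>z\<in>A. (Ps ! m) z * F y z))"
  using assms
proof (induction Ps arbitrary: i m)
  case (Cons P Ps)
  have P: "distribution A P" and Ps: "\<And>Q. Q \<in> set Ps \<Longrightarrow> distribution A Q"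
    using Cons.prems(1) by simp_all
  obtain m' where m': "m = Suc m'" "m' < length Ps" using Cons.prems by (cases m) auto
  show ?case
  proof (cases i)
    case 0
    then show ?thesis by (simp add: indep_expect_Cons distributionD[OF P] m' indep_expect_nth[OF Ps])
  next
    case (Suc i')
    then have "indep_expect A Ps (\<lambda>zs. F (zs ! i') (zs ! m'))
        = (\<Sum>y\<in>A. (Ps ! i') y * (\<Sum>z\<in>A. (Ps ! m') z * F y z))"
      using Cons.IH[OF Ps] Cons.prems(2) m' by simp
    then show ?thesis
      using Suc m' by (simp add: indep_expect_Cons distributionD[OF P] flip: sum_distrib_right)
  qed
qed simp

lemma iid_expect_const: "distribution A P \<Longrightarrow> iid_expect n A P (\<lambda>_. c) = c"
  by (rule indep_expect_const) simp

lemma iid_expect_nth: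
  "distribution A P \<Longrightarrow> m < n \<Longrightarrow> iid_expect n A P (\<lambda>zs. F (zs ! m)) = (\<Sum>z\<in>A. P z * F z)"
  using indep_expect_nth[of "replicate n P" A m F] by simp

lemma iid_expect_nth2:
  "distribution A P \<Longrightarrow> i < m \<Longrightarrow> m < n \<Longrightarrow>
    iid_expect n A P (\<lambda>zs. F (zs ! i) (zs ! m)) = (\<Sum>y\<in>A. P y * (\<Sum>z\<in>A. P z * F y z))"
  using indep_expect_nth2[of "replicate n P" A i m F] by simp

lemma indep_expect_chebyshev:
  assumes "\<And>P. P \<in> set Ps \<Longrightarrow> distribution A P" "0 < t"
  shows "indep_expect A Ps (\<lambda>zs. of_bool (t < \<bar>X zs\<bar>)) \<le> indep_expect A Ps (\<lambda>zs. (X zs)\<^sup>2) / t\<^sup>2"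
proof -
  have "indep_expect A Ps (\<lambda>zs. of_bool (t < \<bar>X zs\<bar>)) \<le> indep_expect A Ps (\<lambda>zs. (1 / t\<^sup>2) * (X zs)\<^sup>2)"
  proof (rule indep_expect_mono[OF assms(1)])
    fix zs
    show "of_bool (t < \<bar>X zs\<bar>) \<le> (1 / t\<^sup>2) * (X zs)\<^sup>2"
      using assms(2) abs_le_square_iff[of t "X zs"] by (auto simp: le_less)
  qed
  then show ?thesis by (simp only: indep_expect_cmult) simp
qed

lemma distribution_seqs:
  assumes "distribution A P"
  shows "distribution (seqs n A) (\<lambda>zs. prod_list (map P zs))"
  unfolding distribution_def
proof (intro conjI ballI)
  show "finite (seqs n A)" using assms by (simp add: finite_seqs distributionD)
  show "0 \<le> prod_list (map P zs)" if "zs \<in> seqs n A" for zs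
    using that assms by (intro prod_list_nonneg) (auto simp: seqs_def distribution_def)
  show "(\<Sum>zs\<in>seqs n A. prod_list (map P zs)) = 1"
    using iid_expect_const[OF assms, of n 1] by (simp add: iid_expect_eq_sum)
qed

lemma iid_expect_sum_list_centered:
  assumes "distribution A P" "(\<Sum>z\<in>A. P z * h z) = 0"
  shows "iid_expect n A P (\<lambda>zs. \<Sum>z\<leftarrow>zs. h z) = 0"
proof (induction n)
  case (Suc n)
  then show ?case
    using assms by (simp add: indep_expect_Cons distributionD(1) indep_expect_add iid_expect_const)
qed (simp add: indep_expect_Nil)

lemma iid_expect_sum_list_centered_power2:
  assumes "distribution A P" "(\<Sum>z\<in>A. P z * h z) = 0"
  shows "iid_expect n A P (\<lambda>zs. (\<Sum>z\<leftarrow>zs. h z)\<^sup>2) = real n * (\<Sum>z\<in>A. P z * (h z)\<^sup>2)"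
proof (induction n)
  case (Suc n)
  let ?X = "\<lambda>zs. \<Sum>z\<leftarrow>zs. h z"
  note P = distributionD[OF assms(1)]
  have "iid_expect n A P (\<lambda>zs. (h z + ?X zs)\<^sup>2) = (h z)\<^sup>2 + iid_expect n A P (\<lambda>zs. (?X zs)\<^sup>2)" for z
  proof -
    have "(h z + ?X zs)\<^sup>2 = (h z)\<^sup>2 + (2 * h z) * ?X zs + (?X zs)\<^sup>2" for zs
      by (simp add: power2_sum)
    then show ?thesis
      by (simp only: indep_expect_add indep_expect_cmult iid_expect_const[OF assms(1)]
          iid_expect_sum_list_centered[OF assms])
  qed
  then show ?case
    using Suc by (simp add: indep_expect_Cons P(1) distrib_left sum.distrib flip: sum_distrib_right)
      (simp add: P(3) distrib_right)
qed (simp add: indep_expect_Nil)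

lemma iid_expect_count_list:
  assumes "distribution A P" "a \<in> A"
  shows "iid_expect n A P (\<lambda>zs. real (count_list zs a) - P a * real n) = 0"
    and "iid_expect n A P (\<lambda>zs. (real (count_list zs a) - P a * real n)\<^sup>2) = real n * (P a * (1 - P a))"
proof -
  let ?h = "\<lambda>z. of_bool (z = a) - P a :: real"
  note P = distributionD[OF assms(1)]
  have indicator: "(\<Sum>z\<in>A. P z * of_bool (z = a)) = P a"
    using P(1) assms(2) by simp
  have "P z * ?h z = P z * of_bool (z = a) - P a * P z" for z by (simp add: algebra_simps)
  then have mean: "(\<Sum>z\<in>A. P z * ?h z) = 0"
    by (simp only: sum_subtractf indicator) (simp add: P(3) flip: sum_distrib_left)
  have "P z * (?h z)\<^sup>2 = (1 - 2 * P a) * (P z * of_bool (z = a)) + (P a)\<^sup>2 * P z" for z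
    by (cases "z = a") (simp_all add: power2_eq_square algebra_simps)
  then have var: "(\<Sum>z\<in>A. P z * (?h z)\<^sup>2) = P a * (1 - P a)"
    by (simp only: sum.distrib indicator flip: sum_distrib_left)
      (simp add: P(3) power2_eq_square algebra_simps flip: sum_distrib_left)
  have "(\<Sum>z\<leftarrow>zs. ?h z) = real (count_list zs a) - P a * real (length zs)" for zs
    by (induction zs) (simp_all add: algebra_simps)
  then have count: "real (count_list zs a) - P a * real n = (\<Sum>z\<leftarrow>zs. ?h z)"
    if "zs \<in> seqs (length (replicate n P)) A" for zs
    using that by (simp add: seqs_def)
  show "iid_expect n A P (\<lambda>zs. real (count_list zs a) - P a * real n) = 0"
    using iid_expect_sum_list_centered[OF assms(1) mean, of n]
    by (simp only: count cong: indep_expect_cong)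
  show "iid_expect n A P (\<lambda>zs. (real (count_list zs a) - P a * real n)\<^sup>2) = real n * (P a * (1 - P a))"
    using iid_expect_sum_list_centered_power2[OF assms(1) mean, of n]
    by (simp only: count var cong: indep_expect_cong)
qed

definition typical :: "'a set \<Rightarrow> ('a \<Rightarrow> real) \<Rightarrow> real \<Rightarrow> 'a list \<Rightarrow> bool" where
  "typical A P \<delta> zs \<longleftrightarrow>
     (\<forall>a\<in>A. \<bar>real (count_list zs a) - P a * real (length zs)\<bar> \<le> \<delta> * P a * real (length zs))"

lemma prob_letter_atypical_le:
  assumes "distribution A P" "a \<in> A" "0 < \<delta>" "0 < n"
  shows "iid_expect n A P (\<lambda>zs. of_bool (\<delta> * P a * real n < \<bar>real (count_list zs a) - P a * real n\<bar>))
    \<le> 1 / (\<delta>\<^sup>2 * P a) / real n"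
proof (cases "P a = 0")
  case True
  have "iid_expect n A P (\<lambda>zs. of_bool (\<delta> * P a * real n < \<bar>real (count_list zs a) - P a * real n\<bar>))
    \<le> iid_expect n A P (\<lambda>zs. real (count_list zs a) - P a * real n)"
    using assms(1) by (intro indep_expect_mono) (auto simp: True)
  then show ?thesis using iid_expect_count_list(1)[OF assms(1,2), of n] True by simp
next
  case False
  then have pos: "0 < P a" using distributionD(2)[OF assms(1,2)] by simp
  then have "0 < \<delta> * P a * real n" using assms by simp
  then have "iid_expect n A P (\<lambda>zs. of_bool (\<delta> * P a * real n < \<bar>real (count_list zs a) - P a * real n\<bar>))
    \<le> real n * (P a * (1 - P a)) / (\<delta> * P a * real n)\<^sup>2"
    using indep_expect_chebyshev[of "replicate n P" A "\<delta> * P a * real n"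
        "\<lambda>zs. real (count_list zs a) - P a * real n"]
      iid_expect_count_list(2)[OF assms(1,2)] assms(1) by simp
  also have "\<dots> = (1 - P a) / (\<delta>\<^sup>2 * P a) / real n"
    using pos assms(3,4) by (simp add: power2_eq_square field_simps)
  also have "\<dots> \<le> 1 / (\<delta>\<^sup>2 * P a) / real n"
    using pos by (intro divide_right_mono) auto
  finally show ?thesis .
qed

text \<open>Letters of probability \<open>0\<close> do not contribute to the sum, since \<open>1 / 0 = 0\<close>.\<close>
lemma prob_atypical_le:
  assumes "distribution A P" "0 < \<delta>" "0 < n"
  shows "iid_expect n A P (\<lambda>zs. of_bool (\<not> typical A P \<delta> zs)) \<le> (\<Sum>a\<in>A. 1 / (\<delta>\<^sup>2 * P a)) / real n"
proof -
  let ?B = "\<lambda>a zs. of_bool (\<delta> * P a * real n < \<bar>real (count_list zs a) - P a * real n\<bar>) :: real"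
  have "iid_expect n A P (\<lambda>zs. of_bool (\<not> typical A P \<delta> zs)) \<le> iid_expect n A P (\<lambda>zs. \<Sum>a\<in>A. ?B a zs)"
  proof (rule indep_expect_mono)
    fix zs assume zs: "zs \<in> seqs (length (replicate n P)) A"
    show "of_bool (\<not> typical A P \<delta> zs) \<le> (\<Sum>a\<in>A. ?B a zs)"
    proof (cases "typical A P \<delta> zs")
      case True
      then show ?thesis by (simp add: sum_nonneg)
    next
      case False
      then obtain a where a: "a \<in> A" "?B a zs = 1" using zs by (auto simp: typical_def seqs_def not_le)
      then show ?thesis
        using member_le_sum[of a A "\<lambda>a. ?B a zs"] distributionD(1)[OF assms(1)] False by simp
    qed
  qed (use assms(1) in simp)
  also have "\<dots> \<le> (\<Sum>a\<in>A. 1 / (\<delta>\<^sup>2 * P a) / real n)"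
    unfolding indep_expect_sum by (intro sum_mono prob_letter_atypical_le assms)
  finally show ?thesis by (simp add: sum_divide_distrib)
qed

definition shannon_entropy :: "'a set \<Rightarrow> ('a \<Rightarrow> real) \<Rightarrow> real" where
  "shannon_entropy A P = - (\<Sum>a\<in>A. P a * log 2 (P a))"

lemma prod_list_eq_prod_count_list:
  fixes g :: "'a \<Rightarrow> 'b :: comm_monoid_mult"
  assumes "finite A" "set zs \<subseteq> A"
  shows "prod_list (map g zs) = (\<Prod>a\<in>A. g a ^ count_list zs a)"
  using assms(2)
proof (induction zs)
  case (Cons z zs)
  have "(\<Prod>a\<in>A. g a ^ count_list (z # zs) a)
    = (\<Prod>a\<in>A. (if z = a then g a else 1) * g a ^ count_list zs a)"
    by (intro prod.cong) auto
  also have "\<dots> = g z * (\<Prod>a\<in>A. g a ^ count_list zs a)"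
    using Cons.prems assms(1) by (simp add: prod.distrib prod.delta)
  finally show ?case using Cons by simp
qed simp

lemma power_eq_powr_log: "0 < x \<Longrightarrow> x ^ m = 2 powr (real m * log 2 x)"
  by (simp add: powr_powr[symmetric] powr_realpow mult.commute[of "real _"])

lemma prod_list_le_powr:
  assumes "finite A" "set zs \<subseteq> A" "\<And>a. a \<in> A \<Longrightarrow> 0 \<le> g a \<and> g a \<le> 1"
    and lower: "\<And>a. a \<in> A \<Longrightarrow> l a \<le> real (count_list zs a)"
  shows "prod_list (map g zs) \<le> 2 powr (\<Sum>a\<in>A. l a * log 2 (g a))"
proof -
  have "g a ^ count_list zs a \<le> 2 powr (l a * log 2 (g a))" if a: "a \<in> A" for a
  proof (cases "g a = 0")
    case True
    then show ?thesis by (simp add: power_0_left log_def)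
  next
    case False
    then have "0 < g a" using assms(3)[OF a] by simp
    then show ?thesis
      using assms(3)[OF a] lower[OF a] by (simp add: power_eq_powr_log mult_right_mono_neg)
  qed
  then have "(\<Prod>a\<in>A. g a ^ count_list zs a) \<le> (\<Prod>a\<in>A. 2 powr (l a * log 2 (g a)))"
    by (intro prod_mono) (use assms(3) in auto)
  then show ?thesis by (simp add: prod_list_eq_prod_count_list[OF assms(1,2)] powr_sum assms(1))
qed

lemma prod_list_ge_powr:
  assumes "finite A" "set zs \<subseteq> A" "\<And>a. a \<in> A \<Longrightarrow> 0 \<le> g a \<and> g a \<le> 1"
    and upper: "\<And>a. a \<in> A \<Longrightarrow> real (count_list zs a) \<le> u a"
    and zero: "\<And>a. a \<in> A \<Longrightarrow> g a = 0 \<Longrightarrow> count_list zs a = 0"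
  shows "2 powr (\<Sum>a\<in>A. u a * log 2 (g a)) \<le> prod_list (map g zs)"
proof -
  have "2 powr (u a * log 2 (g a)) \<le> g a ^ count_list zs a" if a: "a \<in> A" for a
  proof (cases "g a = 0")
    case True
    then show ?thesis using zero[OF a] by (simp add: log_def)
  next
    case False
    then have "0 < g a" using assms(3)[OF a] by simp
    then show ?thesis
      using assms(3)[OF a] upper[OF a] by (simp add: power_eq_powr_log mult_right_mono_neg)
  qed
  then have "(\<Prod>a\<in>A. 2 powr (u a * log 2 (g a))) \<le> (\<Prod>a\<in>A. g a ^ count_list zs a)"
    by (intro prod_mono) auto
  then show ?thesis by (simp add: prod_list_eq_prod_count_list[OF assms(1,2)] powr_sum assms(1))
qed

lemma prob_typical_seq_le:
  assumes "distribution A P" "zs \<in> seqs n A" "typical A P \<delta> zs"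
  shows "prod_list (map P zs) \<le> 2 powr (- (real n * (1 - \<delta>) * shannon_entropy A P))"
proof -
  note P = distributionD[OF assms(1)]
  have "prod_list (map P zs) \<le> 2 powr (\<Sum>a\<in>A. ((1 - \<delta>) * real n * P a) * log 2 (P a))"
  proof (rule prod_list_le_powr[OF P(1)])
    show "set zs \<subseteq> A" using assms(2) by (simp add: seqs_def)
    fix a assume a: "a \<in> A"
    show "0 \<le> P a \<and> P a \<le> 1" using P(2)[OF a] distribution_le_1[OF assms(1) a] by simp
    have "\<bar>real (count_list zs a) - P a * real n\<bar> \<le> \<delta> * P a * real n"
      using assms(2,3) a by (auto simp: typical_def seqs_def)
    then show "(1 - \<delta>) * real n * P a \<le> real (count_list zs a)" by (simp add: algebra_simps)
  qed
  also have "(\<Sum>a\<in>A. ((1 - \<delta>) * real n * P a) * log 2 (P a)) = - (real n * (1 - \<delta>) * shannon_entropy A P)"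
    by (simp add: shannon_entropy_def sum_distrib_left mult_ac)
  finally show ?thesis .
qed

section \<open>Joint distributions and conditional typicality\<close>

definition joint :: "('a \<Rightarrow> real) \<Rightarrow> ('a \<Rightarrow> 'b \<Rightarrow> real) \<Rightarrow> 'a \<times> 'b \<Rightarrow> real" where
  "joint P Q = (\<lambda>(x, y). P x * Q x y)"

definition cond_entropy :: "'a set \<Rightarrow> ('a \<Rightarrow> real) \<Rightarrow> 'b set \<Rightarrow> ('a \<Rightarrow> 'b \<Rightarrow> real) \<Rightarrow> real" where
  "cond_entropy A P B Q = (\<Sum>x\<in>A. P x * shannon_entropy B (Q x))"

lemma sum_joint:
  fixes F :: "'a \<times> 'b \<Rightarrow> 'c :: real_vector"
  shows "(\<Sum>z\<in>A \<times> B. joint P Q z *\<^sub>R F z) = (\<Sum>x\<in>A. P x *\<^sub>R (\<Sum>y\<in>B. Q x y *\<^sub>R F (x, y)))"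
  by (simp add: joint_def sum.cartesian_product' scaleR_sum_right)

lemma distribution_joint:
  assumes "distribution A P" "\<And>x. x \<in> A \<Longrightarrow> distribution B (Q x)"
  shows "distribution (A \<times> B) (joint P Q)"
proof -
  have "finite B"
    using assms by (metis distribution_def finite.emptyI sum.empty zero_neq_one ex_in_conv)
  moreover have "sum (joint P Q) (A \<times> B) = 1"
    using sum_joint[of P Q "\<lambda>_. 1 :: real" A B] assms by (simp add: distributionD)
  ultimately show ?thesis
    using assms by (auto simp: distribution_def joint_def)
qed

lemma shannon_entropy_joint:
  assumes "distribution A P" "\<And>x. x \<in> A \<Longrightarrow> distribution B (Q x)"
  shows "shannon_entropy (A \<times> B) (joint P Q) = shannon_entropy A P + cond_entropy A P B Q"
proof -
  have "joint P Q (x, y) * log 2 (joint P Q (x, y))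
      = P x * log 2 (P x) * Q x y + P x * (Q x y * log 2 (Q x y))"
    if "x \<in> A" "y \<in> B" for x y
  proof (cases "P x = 0 \<or> Q x y = 0")
    case False
    then have "0 < P x" "0 < Q x y"
      using distributionD(2)[OF assms(1)] distributionD(2)[OF assms(2)] that by (auto simp: less_le)
    then show ?thesis by (simp add: joint_def log_mult algebra_simps)
  qed (auto simp: joint_def)
  then have "shannon_entropy (A \<times> B) (joint P Q)
      = - (\<Sum>x\<in>A. P x * log 2 (P x) * sum (Q x) B + P x * (\<Sum>y\<in>B. Q x y * log 2 (Q x y)))"
    by (simp add: shannon_entropy_def sum.cartesian_product' sum.distrib sum_distrib_left)
  also have "\<dots> = shannon_entropy A P + cond_entropy A P B Q"
    using assms(2)
    by (simp add: shannon_entropy_def cond_entropy_def distributionD sum.distrib sum_negf)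
  finally show ?thesis .
qed

lemma prod_list_joint_zip:
  assumes "length xs = length ys"
  shows "prod_list (map (joint P Q) (zip xs ys)) = prod_list (map P xs) * prod_list (map2 Q xs ys)"
  using assms by (induction xs ys rule: list_induct2) (auto simp: joint_def)

lemma iid_expect_joint:
  "iid_expect n (A \<times> B) (joint P Q) F
    = iid_expect n A P (\<lambda>xs. indep_expect B (map Q xs) (\<lambda>ys. F (zip xs ys)))"
  unfolding iid_expect_eq_sum indep_expect_map_eq_sum sum_seqs_zip sum_distrib_left
  by (intro sum.cong) (auto simp: prod_list_joint_zip seqs_def mult.assoc)

lemma count_list_map_fst:
  assumes "finite B" "set zs \<subseteq> A \<times> B"
  shows "count_list (map fst zs) x = (\<Sum>y\<in>B. count_list zs (x, y))"
  using assms(2)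
proof (induction zs)
  case (Cons z zs)
  obtain a b where z: "z = (a, b)" "b \<in> B" using Cons.prems by auto
  have "(\<Sum>y\<in>B. count_list (z # zs) (x, y))
      = (\<Sum>y\<in>B. (if y = b then of_bool (a = x) else 0) + count_list zs (x, y))"
    by (intro sum.cong) (auto simp: z)
  also have "\<dots> = of_bool (a = x) + (\<Sum>y\<in>B. count_list zs (x, y))"
    using z assms(1) by (simp add: sum.distrib)
  finally show ?case using Cons z by simp
qed simp

lemma typical_map_fst:
  assumes joint_typical: "typical (A \<times> B) (joint P Q) \<delta> zs" and zs: "set zs \<subseteq> A \<times> B"
    and Q: "\<And>x. x \<in> A \<Longrightarrow> distribution B (Q x)"
  shows "typical A P \<delta> (map fst zs)"
  unfolding typical_def length_map
proof
  fix x assume x: "x \<in> A"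
  let ?n = "real (length zs)"
  note Qx = distributionD[OF Q[OF x]]
  have "real (count_list (map fst zs) x) - P x * ?n
      = (\<Sum>y\<in>B. real (count_list zs (x, y)) - Q x y * (P x * ?n))"
    by (simp add: count_list_map_fst[OF Qx(1) zs] sum_subtractf Qx(3) flip: sum_distrib_right)
  also have "\<bar>\<dots>\<bar> \<le> (\<Sum>y\<in>B. \<bar>real (count_list zs (x, y)) - Q x y * (P x * ?n)\<bar>)" by (rule sum_abs)
  also have "\<dots> \<le> (\<Sum>y\<in>B. Q x y * (\<delta> * P x * ?n))"
    using joint_typical x by (intro sum_mono) (auto simp: typical_def joint_def mult_ac)
  also have "\<dots> = \<delta> * P x * ?n" by (simp add: Qx(3) flip: sum_distrib_right)
  finally show "\<bar>real (count_list (map fst zs) x) - P x * ?n\<bar> \<le> \<delta> * P x * ?n" .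
qed

lemma typical_mono:
  assumes "typical A P \<delta> zs" "\<delta> \<le> \<epsilon>" "distribution A P"
  shows "typical A P \<epsilon> zs"
  unfolding typical_def
proof
  fix a assume a: "a \<in> A"
  have "\<bar>real (count_list zs a) - P a * real (length zs)\<bar> \<le> \<delta> * P a * real (length zs)"
    using assms(1) a by (simp add: typical_def)
  also have "\<dots> \<le> \<epsilon> * P a * real (length zs)"
    using assms(2) distributionD(2)[OF assms(3) a] by (intro mult_right_mono) auto
  finally show "\<bar>real (count_list zs a) - P a * real (length zs)\<bar> \<le> \<epsilon> * P a * real (length zs)" .
qed

lemma mem_typical_set_iff:
  assumes "0 < n"
  shows "xs \<in> typical_set k p \<delta> n \<longleftrightarrow> xs \<in> seqs n {0..<k} \<and> typical {0..<k} p \<delta> xs"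
proof -
  have "\<bar>c / real n - p x\<bar> \<le> \<delta> * p x \<longleftrightarrow> \<bar>c - p x * real n\<bar> \<le> \<delta> * p x * real n" for c x
  proof -
    have "c / real n - p x = (c - p x * real n) / real n" using assms by (simp add: field_simps)
    then show ?thesis using assms by (simp add: abs_divide pos_divide_le_eq)
  qed
  then show ?thesis by (auto simp: typical_set_def typical_def seqs_def)
qed

text \<open>The marginal count is within \<open>\<delta> / 4\<close> of its mean too, so it is at least half of its mean; this
  absorbs the two errors of size \<open>\<delta> / 4\<close> into \<open>\<delta>\<close> times the marginal count.\<close>
lemma cond_typical_if_typical_joint:
  assumes "distribution {0..<k} p" "\<And>x. x < k \<Longrightarrow> distribution {0..<d} (q x)"
    and zs: "set zs \<subseteq> {0..<k} \<times> {0..<d}" and \<delta>: "0 < \<delta>" "\<delta> \<le> 1"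
    and joint_typical: "typical ({0..<k} \<times> {0..<d}) (joint p q) (\<delta> / 4) zs"
  shows "cond_typical k d q \<delta> (map fst zs) (map snd zs)"
  unfolding cond_typical_def
proof (intro allI impI)
  fix x s assume x: "x < k" and s: "s < d"
  define N where "N = real (count_list zs (x, s))"
  define L where "L = real (count_list (map fst zs) x)"
  define \<mu> where "\<mu> = p x * real (length zs)"
  have q: "0 \<le> q x s" and \<mu>: "0 \<le> \<mu>"
    using distributionD(2)[OF assms(2)[OF x]] distributionD(2)[OF assms(1)] x s by (auto simp: \<mu>_def)
  have N_close: "\<bar>N - q x s * \<mu>\<bar> \<le> \<delta> / 4 * (q x s * \<mu>)"
    using joint_typical x s by (auto simp: typical_def joint_def N_def \<mu>_def mult_ac)
  have "typical {0..<k} p (\<delta> / 4) (map fst zs)"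
    by (rule typical_map_fst[OF joint_typical zs]) (simp add: assms(2))
  then have L_close: "\<bar>L - \<mu>\<bar> \<le> \<delta> / 4 * \<mu>" using x by (auto simp: typical_def L_def \<mu>_def mult_ac)
  have "\<bar>N - q x s * L\<bar> = \<bar>(N - q x s * \<mu>) - q x s * (L - \<mu>)\<bar>" by (simp add: algebra_simps)
  also have "\<dots> \<le> \<delta> / 4 * (q x s * \<mu>) + q x s * (\<delta> / 4 * \<mu>)"
    using abs_triangle_ineq4[of "N - q x s * \<mu>" "q x s * (L - \<mu>)"] N_close mult_left_mono[OF L_close q]
    unfolding abs_mult abs_of_nonneg[OF q] by linarith
  also have "\<dots> = \<delta> * q x s * (\<mu> / 2)" by simp
  also have "\<dots> \<le> \<delta> * q x s * L"
  proof (rule mult_left_mono)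
    have "\<delta> / 4 * \<mu> \<le> 1 / 2 * \<mu>" using \<delta> \<mu> by (intro mult_right_mono) auto
    then show "\<mu> / 2 \<le> L" using L_close by linarith
    show "0 \<le> \<delta> * q x s" using \<delta> q by simp
  qed
  finally show "\<bar>real (count_list (zip (map fst zs) (map snd zs)) (x, s))
        - q x s * real (count_list (map fst zs) x)\<bar>
     \<le> \<delta> * q x s * real (count_list (map fst zs) x)"
    by (simp add: N_def L_def zip_map_fst_snd)
qed

definition cond_typical_seqs :: "nat \<Rightarrow> nat \<Rightarrow> (nat \<Rightarrow> nat \<Rightarrow> real) \<Rightarrow> real \<Rightarrow> nat list \<Rightarrow> nat list set" where
  "cond_typical_seqs k d q \<delta> xs = {ss \<in> seqs (length xs) {0..<d}. cond_typical k d q \<delta> xs ss}"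

lemma finite_cond_typical_seqs: "finite (cond_typical_seqs k d q \<delta> xs)"
  by (simp add: cond_typical_seqs_def finite_seqs)

lemma prob_cond_typical_seq_ge:
  assumes "distribution {0..<k} p" and q: "\<And>x. x < k \<Longrightarrow> distribution {0..<d} (q x)"
    and xs: "xs \<in> seqs n {0..<k}" "typical {0..<k} p \<delta> xs" and "0 \<le> \<delta>"
    and ss: "ss \<in> cond_typical_seqs k d q \<delta> xs"
  shows "2 powr (- (real n * (1 + \<delta>)\<^sup>2 * cond_entropy {0..<k} p {0..<d} q)) \<le> prod_list (map2 q xs ss)"
proof -
  let ?u = "\<lambda>z. (1 + \<delta>)\<^sup>2 * real n * joint p q z"
  have len: "length xs = n" using xs by (simp add: seqs_def)
  have "2 powr (\<Sum>z\<in>{0..<k} \<times> {0..<d}. ?u z * log 2 (case_prod q z))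
      \<le> prod_list (map (case_prod q) (zip xs ss))"
  proof (rule prod_list_ge_powr)
    show "set (zip xs ss) \<subseteq> {0..<k} \<times> {0..<d}"
      using zip_mem_seqs[OF xs(1), of ss "{0..<d}"] ss len by (simp add: cond_typical_seqs_def seqs_def)
    fix z assume "z \<in> {0..<k} \<times> {0..<d}"
    then obtain x s where z: "z = (x, s)" "x < k" "s < d" by auto
    have q01: "0 \<le> q x s" "q x s \<le> 1"
      using distributionD(2)[OF q] distribution_le_1[OF q] z by auto
    then show "0 \<le> case_prod q z \<and> case_prod q z \<le> 1" by (simp add: z)
    have "\<bar>real (count_list (zip xs ss) (x, s)) - q x s * real (count_list xs x)\<bar>
        \<le> \<delta> * q x s * real (count_list xs x)"
      using ss z by (simp add: cond_typical_seqs_def cond_typical_def)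
    then have upper: "real (count_list (zip xs ss) z) \<le> (1 + \<delta>) * q x s * real (count_list xs x)"
      by (simp add: z algebra_simps)
    have "\<bar>real (count_list xs x) - p x * real n\<bar> \<le> \<delta> * p x * real n"
      using xs z by (simp add: typical_def len)
    then have "real (count_list xs x) \<le> (1 + \<delta>) * p x * real n" by (simp add: algebra_simps)
    then have "(1 + \<delta>) * q x s * real (count_list xs x) \<le> (1 + \<delta>) * q x s * ((1 + \<delta>) * p x * real n)"
      using \<open>0 \<le> \<delta>\<close> q01 by (intro mult_left_mono) auto
    also have "\<dots> = ?u z" by (simp add: z joint_def power2_eq_square)
    finally show "real (count_list (zip xs ss) z) \<le> ?u z" using upper by linarith
    show "count_list (zip xs ss) z = 0" if "case_prod q z = 0"
      using upper that by (simp add: z)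
  qed simp
  also have "(\<Sum>z\<in>{0..<k} \<times> {0..<d}. ?u z * log 2 (case_prod q z))
      = (1 + \<delta>)\<^sup>2 * real n * (\<Sum>z\<in>{0..<k} \<times> {0..<d}. joint p q z *\<^sub>R log 2 (case_prod q z))"
    by (simp add: sum_distrib_left mult.assoc)
  also have "\<dots> = - (real n * (1 + \<delta>)\<^sup>2 * cond_entropy {0..<k} p {0..<d} q)"
    unfolding sum_joint by (simp add: cond_entropy_def shannon_entropy_def sum_negf)
  finally show ?thesis .
qed

lemma card_cond_typical_seqs_le:
  assumes "distribution {0..<k} p" "\<And>x. x < k \<Longrightarrow> distribution {0..<d} (q x)"
    and xs: "xs \<in> seqs n {0..<k}" "typical {0..<k} p \<delta> xs" and "0 \<le> \<delta>"
  shows "real (card (cond_typical_seqs k d q \<delta> xs))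
      \<le> 2 powr (real n * (1 + \<delta>)\<^sup>2 * cond_entropy {0..<k} p {0..<d} q)"
proof -
  let ?T = "cond_typical_seqs k d q \<delta> xs"
  let ?H = "real n * (1 + \<delta>)\<^sup>2 * cond_entropy {0..<k} p {0..<d} q"
  have q: "distribution {0..<d} Q" if "Q \<in> set (map q xs)" for Q
    using that xs assms(2) by (auto simp: seqs_def)
  have "real (card ?T) * 2 powr (- ?H) = (\<Sum>ss\<in>?T. 2 powr (- ?H))" by simp
  also have "\<dots> \<le> (\<Sum>ss\<in>?T. prod_list (map2 q xs ss))"
    by (intro sum_mono prob_cond_typical_seq_ge[OF assms])
  also have "\<dots> = indep_expect {0..<d} (map q xs) (\<lambda>ss. of_bool (cond_typical k d q \<delta> xs ss))"
    unfolding indep_expect_map_eq_sum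
    by (rule sum.mono_neutral_cong_left) (auto simp: cond_typical_seqs_def finite_seqs)
  also have "\<dots> \<le> indep_expect {0..<d} (map q xs) (\<lambda>_. 1)"
    by (intro indep_expect_mono q) auto
  also have "\<dots> = 1" by (rule indep_expect_const[OF q])
  finally show ?thesis by (simp add: powr_minus field_simps)
qed

section \<open>Adjoints, projections and sequential measurements\<close>

lemma cscalar_prod_sum:
  fixes u v :: "complex vec"
  assumes "u \<in> carrier_vec D" "v \<in> carrier_vec D"
  shows "u \<bullet>c v = (\<Sum>i\<in>{0..<D}. u $ i * cnj (v $ i))"
  using assms by (simp add: scalar_prod_def)

lemma cnj_cscalar_prod:
  fixes u v :: "complex vec"
  assumes "u \<in> carrier_vec D" "v \<in> carrier_vec D"
  shows "cnj (u \<bullet>c v) = v \<bullet>c u"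
  using assms by (simp add: cscalar_prod_sum[of _ D] mult.commute)

lemma cscalar_prod_minus_left:
  fixes u v w :: "complex vec"
  assumes "u \<in> carrier_vec D" "v \<in> carrier_vec D" "w \<in> carrier_vec D"
  shows "(u - v) \<bullet>c w = u \<bullet>c w - v \<bullet>c w"
  using assms by (simp add: minus_scalar_prod_distrib[of _ D])

lemma cscalar_prod_minus_right:
  fixes u v w :: "complex vec"
  assumes "u \<in> carrier_vec D" "v \<in> carrier_vec D" "w \<in> carrier_vec D"
  shows "w \<bullet>c (u - v) = w \<bullet>c u - w \<bullet>c v"
proof -
  have "w \<bullet>c (u - v) = cnj ((u - v) \<bullet>c w)" using assms by (intro cnj_cscalar_prod[symmetric]) auto
  then show ?thesis
    using assms by (simp add: cscalar_prod_minus_left[of _ D] cnj_cscalar_prod[of _ D])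
qed

lemma cscalar_prod_smult:
  fixes u v :: "complex vec"
  assumes "u \<in> carrier_vec D" "v \<in> carrier_vec D"
  shows "(c \<cdot>\<^sub>v u) \<bullet>c v = c * (u \<bullet>c v)" "u \<bullet>c (c \<cdot>\<^sub>v v) = cnj c * (u \<bullet>c v)"
  using assms by (simp_all add: conjugate_smult_vec)

definition sq_norm :: "complex vec \<Rightarrow> real" where
  "sq_norm v = Re (v \<bullet>c v)"

lemma cscalar_prod_self: "v \<bullet>c v = complex_of_real (sq_norm v)"
  using conjugate_square_ge_0_vec[of v] by (simp add: sq_norm_def less_eq_complex_def complex_eq_iff)

lemma sq_norm_nonneg: "0 \<le> sq_norm v"
  using conjugate_square_ge_0_vec[of v] by (simp add: sq_norm_def less_eq_complex_def)

lemma sq_norm_eq_0_iff: "v \<in> carrier_vec D \<Longrightarrow> sq_norm v = 0 \<longleftrightarrow> v = 0\<^sub>v D"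
  using conjugate_square_eq_0_vec[of v D] by (simp add: cscalar_prod_self)

lemma sq_norm_zero: "sq_norm (0\<^sub>v D) = 0"
  by (simp add: sq_norm_def)

lemma sq_norm_smult:
  assumes "v \<in> carrier_vec D"
  shows "sq_norm (c \<cdot>\<^sub>v v) = (cmod c)\<^sup>2 * sq_norm v"
proof -
  have "(c \<cdot>\<^sub>v v) \<bullet>c (c \<cdot>\<^sub>v v) = (c * cnj c) * (v \<bullet>c v)"
    using cscalar_prod_smult(1)[of v D "c \<cdot>\<^sub>v v" c] cscalar_prod_smult(2)[OF assms assms, of c] assms
    by simp
  also have "\<dots> = complex_of_real ((cmod c)\<^sup>2 * sq_norm v)"
    by (simp only: complex_norm_square of_real_mult cscalar_prod_self)
  finally show ?thesis by (simp only: cscalar_prod_self of_real_eq_iff)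
qed

lemma sq_norm_minus:
  assumes "u \<in> carrier_vec D" "v \<in> carrier_vec D"
  shows "sq_norm (u - v) = sq_norm u + sq_norm v - 2 * Re (u \<bullet>c v)"
proof -
  have "Re (v \<bullet>c u) = Re (u \<bullet>c v)"
    using cnj_cscalar_prod[OF assms] by (metis complex_cnj(1) complex_surj cnj.sel(1))
  moreover have "(u - v) \<bullet>c (u - v) = (u \<bullet>c u - u \<bullet>c v) - (v \<bullet>c u - v \<bullet>c v)"
    using assms by (simp add: cscalar_prod_minus_left[of _ D] cscalar_prod_minus_right[of _ D])
  ultimately show ?thesis by (simp add: sq_norm_def)
qed

lemma abs_Re_cscalar_prod_le:
  assumes "u \<in> carrier_vec D" "v \<in> carrier_vec D" "0 < c"
  shows "2 * \<bar>Re (u \<bullet>c v)\<bar> \<le> c * sq_norm u + sq_norm v / c"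
proof -
  have "2 * (a * Re (u \<bullet>c v)) \<le> a\<^sup>2 * sq_norm u + sq_norm v" for a :: real
    using sq_norm_nonneg[of "complex_of_real a \<cdot>\<^sub>v u - v"]
      sq_norm_minus[of "complex_of_real a \<cdot>\<^sub>v u" D v] assms
    by (simp add: sq_norm_smult[of _ D])
  from this[of c] this[of "- c"] have "c * (2 * \<bar>Re (u \<bullet>c v)\<bar>) \<le> c * (c * sq_norm u + sq_norm v / c)"
    using assms(3) by (simp add: power2_eq_square distrib_left abs_if)
  then show ?thesis using assms(3) by simp
qed

lemma sq_norm_le_perturb:
  assumes "u \<in> carrier_vec D" "v \<in> carrier_vec D" "0 < c"
  shows "sq_norm u \<le> (1 + c) * sq_norm v + (1 + 1 / c) * sq_norm (v - u)"
proof -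
  have "v - (v - u) = u" using assms by (intro eq_vecI) auto
  then have "sq_norm u = sq_norm v + sq_norm (v - u) - 2 * Re (v \<bullet>c (v - u))"
    using sq_norm_minus[of v D "v - u"] assms by simp
  also have "\<dots> \<le> sq_norm v + sq_norm (v - u) + (c * sq_norm v + sq_norm (v - u) / c)"
    using abs_Re_cscalar_prod_le[of v D "v - u" c] assms by simp
  finally show ?thesis by (simp add: algebra_simps)
qed

lemma mat_adjoint_dim: "dim_row (mat_adjoint A) = dim_col A" "dim_col (mat_adjoint A) = dim_row A"
  by (simp_all add: mat_adjoint_def)

lemma mat_adjoint_carrier: "A \<in> carrier_mat m n \<Longrightarrow> mat_adjoint A \<in> carrier_mat n m"
  by (auto intro!: carrier_matI simp: mat_adjoint_dim)

lemma mat_adjoint_index: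
  fixes A :: "complex mat"
  shows "i < dim_col A \<Longrightarrow> j < dim_row A \<Longrightarrow> mat_adjoint A $$ (i, j) = cnj (A $$ (j, i))"
  by (simp add: mat_adjoint_def mat_of_rows_def)

lemma mat_adjoint_mult:
  fixes A B :: "complex mat"
  assumes "A \<in> carrier_mat l m" "B \<in> carrier_mat m n"
  shows "mat_adjoint (A * B) = mat_adjoint B * mat_adjoint A"
  using assms
  by (intro eq_matI)
    (auto simp: mat_adjoint_index mat_adjoint_dim scalar_prod_def mult.commute intro!: sum.cong)

lemma mat_adjoint_minus:
  fixes A B :: "complex mat"
  assumes "A \<in> carrier_mat m n" "B \<in> carrier_mat m n"
  shows "mat_adjoint (A - B) = mat_adjoint A - mat_adjoint B"
  using assms by (intro eq_matI) (auto simp: mat_adjoint_index mat_adjoint_dim)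

lemma mat_adjoint_one: "mat_adjoint (1\<^sub>m D :: complex mat) = 1\<^sub>m D"
  by (intro eq_matI) (auto simp: mat_adjoint_index mat_adjoint_dim)

lemma cscalar_prod_mat_adjoint:
  fixes A :: "complex mat"
  assumes "A \<in> carrier_mat m n" "v \<in> carrier_vec n" "w \<in> carrier_vec m"
  shows "(A *\<^sub>v v) \<bullet>c w = v \<bullet>c (mat_adjoint A *\<^sub>v w)"
proof -
  have "(A *\<^sub>v v) \<bullet>c w = (\<Sum>i\<in>{0..<m}. \<Sum>j\<in>{0..<n}. A $$ (i, j) * v $ j * cnj (w $ i))"
    using assms by (auto simp: scalar_prod_def sum_distrib_right)
  also have "\<dots> = (\<Sum>j\<in>{0..<n}. v $ j * cnj (\<Sum>i\<in>{0..<m}. cnj (A $$ (i, j)) * w $ i))"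
    by (subst sum.swap) (simp add: sum_distrib_left mult_ac)
  also have "\<dots> = v \<bullet>c (mat_adjoint A *\<^sub>v w)"
    using assms by (auto simp: scalar_prod_def mat_adjoint_index mat_adjoint_dim)
  finally show ?thesis .
qed

lemma mat_eqI_cscalar_prod:
  fixes A B :: "complex mat"
  assumes "A \<in> carrier_mat m n" "B \<in> carrier_mat m n"
    and "\<And>v w. v \<in> carrier_vec n \<Longrightarrow> w \<in> carrier_vec m \<Longrightarrow> (A *\<^sub>v v) \<bullet>c w = (B *\<^sub>v v) \<bullet>c w"
  shows "A = B"
proof (rule eq_matI)
  fix i j assume "i < dim_row B" "j < dim_col B"
  then have ij: "i < m" "j < n" using assms(2) by auto
  have entry: "(C *\<^sub>v unit_vec n j) \<bullet>c unit_vec m i = C $$ (i, j)"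
    if "C \<in> carrier_mat m n" for C :: "complex mat"
  proof -
    have "conjugate (unit_vec m i :: complex vec) = unit_vec m i" using ij by (intro eq_vecI) auto
    then show ?thesis using that ij by simp
  qed
  show "A $$ (i, j) = B $$ (i, j)"
    using assms(3)[of "unit_vec n j" "unit_vec m i"] entry[OF assms(1)] entry[OF assms(2)] by simp
qed (use assms in auto)

definition projection :: "nat \<Rightarrow> complex mat \<Rightarrow> bool" where
  "projection D P \<longleftrightarrow> P \<in> carrier_mat D D \<and> mat_adjoint P = P \<and> P * P = P"

lemma projection_carrier: "projection D P \<Longrightarrow> P \<in> carrier_mat D D"
  by (simp add: projection_def)

lemma projection_vec_carrier: "projection D P \<Longrightarrow> v \<in> carrier_vec D \<Longrightarrow> P *\<^sub>v v \<in> carrier_vec D"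
  by (auto dest: projection_carrier)

lemma projection_cscalar_prod:
  assumes "projection D P" "v \<in> carrier_vec D" "w \<in> carrier_vec D"
  shows "(P *\<^sub>v v) \<bullet>c w = v \<bullet>c (P *\<^sub>v w)" "(P *\<^sub>v v) \<bullet>c (P *\<^sub>v w) = v \<bullet>c (P *\<^sub>v w)"
proof -
  have P: "P \<in> carrier_mat D D" "mat_adjoint P = P" "P * P = P"
    using assms(1) by (simp_all add: projection_def)
  then show "(P *\<^sub>v v) \<bullet>c w = v \<bullet>c (P *\<^sub>v w)" using cscalar_prod_mat_adjoint[OF P(1) assms(2,3)] by simp
  have "P *\<^sub>v (P *\<^sub>v w) = P *\<^sub>v w" using P assms(3) by (metis assoc_mult_mat_vec)
  then show "(P *\<^sub>v v) \<bullet>c (P *\<^sub>v w) = v \<bullet>c (P *\<^sub>v w)"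
    using cscalar_prod_mat_adjoint[OF P(1) assms(2), of "P *\<^sub>v w"] P assms(3) by simp
qed

lemma projection_zero: "projection D (0\<^sub>m D D)"
  unfolding projection_def by (auto intro!: eq_matI simp: mat_adjoint_index mat_adjoint_dim)

lemma projection_compl:
  assumes "projection D P"
  shows "projection D (1\<^sub>m D - P)"
proof -
  have P: "P \<in> carrier_mat D D" "mat_adjoint P = P" "P * P = P"
    using assms by (simp_all add: projection_def)
  have "(1\<^sub>m D - P) * (1\<^sub>m D - P) = (1\<^sub>m D - P) - (P - P)"
    using P minus_mult_distrib_mat[of "1\<^sub>m D" D D P "1\<^sub>m D - P" D]
      mult_minus_distrib_mat[of P D D "1\<^sub>m D" D P]
    by (simp add: minus_carrier_mat)
  also have "\<dots> = 1\<^sub>m D - P" using P(1) by (intro eq_matI) auto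
  finally show ?thesis
    using P by (simp add: projection_def mat_adjoint_minus[of _ D D] mat_adjoint_one minus_carrier_mat)
qed

lemma projection_compl_vec:
  fixes P :: "complex mat"
  assumes "P \<in> carrier_mat D D" "v \<in> carrier_vec D"
  shows "(1\<^sub>m D - P) *\<^sub>v v = v - P *\<^sub>v v"
  using assms by (simp add: minus_mult_distrib_mat_vec[of _ D D])

lemma sq_norm_projection_compl:
  assumes "projection D P" "v \<in> carrier_vec D"
  shows "sq_norm (v - P *\<^sub>v v) = sq_norm v - sq_norm (P *\<^sub>v v)"
  using sq_norm_minus[OF assms(2) projection_vec_carrier[OF assms]]
    projection_cscalar_prod(2)[OF assms assms(2)]
  by (simp add: sq_norm_def)

lemma sq_norm_projection_le:
  assumes "projection D P" "v \<in> carrier_vec D"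
  shows "sq_norm (P *\<^sub>v v) \<le> sq_norm v"
  using sq_norm_projection_compl[OF assms] sq_norm_nonneg[of "v - P *\<^sub>v v"] by simp

lemma fold_projections_carrier:
  assumes "\<forall>P\<in>set Ps. projection D P" "v \<in> carrier_vec D"
  shows "fold (*\<^sub>v) Ps v \<in> carrier_vec D"
  using assms by (induction Ps arbitrary: v) (auto intro: projection_vec_carrier)

lemma sq_norm_fold_projections_le:
  assumes "\<forall>P\<in>set Ps. projection D P" "v \<in> carrier_vec D"
  shows "sq_norm (fold (*\<^sub>v) Ps v) \<le> sq_norm v"
  using assms
proof (induction Ps arbitrary: v)
  case (Cons P Ps)
  then have "sq_norm (fold (*\<^sub>v) Ps (P *\<^sub>v v)) \<le> sq_norm (P *\<^sub>v v)" by (simp add: projection_vec_carrier)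
  also have "\<dots> \<le> sq_norm v" using Cons.prems by (intro sq_norm_projection_le[of D]) auto
  finally show ?case by simp
qed simp

lemma fold_projections_minus:
  assumes "\<forall>P\<in>set Ps. projection D P" "v \<in> carrier_vec D" "w \<in> carrier_vec D"
  shows "fold (*\<^sub>v) Ps (v - w) = fold (*\<^sub>v) Ps v - fold (*\<^sub>v) Ps w"
  using assms
  by (induction Ps arbitrary: v w)
    (simp_all add: projection_vec_carrier mult_minus_distrib_mat_vec[OF projection_carrier, of D])

text \<open>
  The two inner products telescope to the sum over the steps of \<open>Re \<langle>Q u, Q v\<rangle>\<close>, where \<open>Q\<close> is the
  complement of the step's projection and \<open>v\<close> the current vector; AM-GM splits each of them as
  \<open>|Q u|\<^sup>2 + |Q v|\<^sup>2 / 4\<close>, and the second parts sum to the total loss of squared norm.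
\<close>
lemma Re_cscalar_prod_diff_fold_projections_le:
  assumes "\<forall>P\<in>set Ps. projection D P" "u \<in> carrier_vec D" "v \<in> carrier_vec D"
  shows "Re (u \<bullet>c v) - Re (u \<bullet>c fold (*\<^sub>v) Ps v)
    \<le> (\<Sum>P\<leftarrow>Ps. sq_norm (u - P *\<^sub>v u)) + (sq_norm v - sq_norm (fold (*\<^sub>v) Ps v)) / 4"
  using assms
proof (induction Ps arbitrary: v)
  case (Cons P Ps)
  have P: "projection D P" using Cons.prems by simp
  note u = Cons.prems(2) and v = Cons.prems(3)
  note Pu = projection_vec_carrier[OF P u] and Pv = projection_vec_carrier[OF P v]
  have "Re (u \<bullet>c v) - Re (u \<bullet>c (P *\<^sub>v v)) = Re (u \<bullet>c (v - P *\<^sub>v v))"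
    using u v Pv by (simp add: cscalar_prod_minus_right[of _ D])
  also have "u \<bullet>c (v - P *\<^sub>v v) = (u - P *\<^sub>v u) \<bullet>c (v - P *\<^sub>v v)"
    using projection_cscalar_prod(2)[OF projection_compl[OF P] u v] projection_carrier[OF P] u v
    by (simp add: projection_compl_vec)
  also have "Re \<dots> \<le> sq_norm (u - P *\<^sub>v u) + sq_norm (v - P *\<^sub>v v) / 4"
    using abs_Re_cscalar_prod_le[of "u - P *\<^sub>v u" D "v - P *\<^sub>v v" 2] u v Pu Pv by simp
  also have "sq_norm (v - P *\<^sub>v v) = sq_norm v - sq_norm (P *\<^sub>v v)"
    by (rule sq_norm_projection_compl[OF P v])
  finally have "Re (u \<bullet>c v) - Re (u \<bullet>c (P *\<^sub>v v))
      \<le> sq_norm (u - P *\<^sub>v u) + (sq_norm v - sq_norm (P *\<^sub>v v)) / 4" .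
  moreover have "Re (u \<bullet>c (P *\<^sub>v v)) - Re (u \<bullet>c fold (*\<^sub>v) Ps (P *\<^sub>v v))
    \<le> (\<Sum>P\<leftarrow>Ps. sq_norm (u - P *\<^sub>v u)) + (sq_norm (P *\<^sub>v v) - sq_norm (fold (*\<^sub>v) Ps (P *\<^sub>v v))) / 4"
    using Cons.IH[of "P *\<^sub>v v"] Cons.prems Pv by simp
  ultimately show ?case by (simp add: field_simps)
qed simp

lemma projections_union_bound:
  assumes "\<forall>P\<in>set Ps. projection D P" "v \<in> carrier_vec D"
  shows "sq_norm v - sq_norm (fold (*\<^sub>v) Ps v) \<le> 4 * (\<Sum>P\<leftarrow>Ps. sq_norm (v - P *\<^sub>v v))"
proof -
  have "2 * Re (v \<bullet>c fold (*\<^sub>v) Ps v) \<le> sq_norm v + sq_norm (fold (*\<^sub>v) Ps v)"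
    using abs_Re_cscalar_prod_le[OF assms(2) fold_projections_carrier[OF assms], of 1] by simp
  moreover have "Re (v \<bullet>c v) = sq_norm v" by (simp add: sq_norm_def)
  ultimately show ?thesis using Re_cscalar_prod_diff_fold_projections_le[OF assms assms(2)] by argo
qed

lemma sq_norm_fold_projections_perturb:
  assumes "\<forall>P\<in>set Ps. projection D P" "v \<in> carrier_vec D" "w \<in> carrier_vec D" "0 < c"
  shows "sq_norm (fold (*\<^sub>v) Ps w) \<le> (1 + c) * sq_norm (fold (*\<^sub>v) Ps v) + (1 + 1 / c) * sq_norm (v - w)"
proof -
  have "sq_norm (fold (*\<^sub>v) Ps v - fold (*\<^sub>v) Ps w) \<le> sq_norm (v - w)"
    using sq_norm_fold_projections_le[OF assms(1), of "v - w"] fold_projections_minus[OF assms(1-3)]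
      assms(2,3) by simp
  then have "(1 + 1 / c) * sq_norm (fold (*\<^sub>v) Ps v - fold (*\<^sub>v) Ps w) \<le> (1 + 1 / c) * sq_norm (v - w)"
    using assms(4) by (intro mult_left_mono) auto
  then show ?thesis
    using sq_norm_le_perturb[of "fold (*\<^sub>v) Ps w" D "fold (*\<^sub>v) Ps v" c] fold_projections_carrier assms
    by fastforce
qed

lemma sequential_decoding_error:
  assumes Ps: "\<forall>P\<in>set Ps. projection D P" and Q: "projection D Q" and P0: "projection D P0"
    and v: "v \<in> carrier_vec D" "sq_norm v = 1" and c: "0 < c"
  shows "1 - sq_norm (fold (*\<^sub>v) (map (\<lambda>P. 1\<^sub>m D - P) Ps @ [Q]) v)
    \<le> c + (10 + 1 / c) * sq_norm (v - P0 *\<^sub>v v) + 4 * (\<Sum>P\<leftarrow>Ps. sq_norm (P *\<^sub>v (P0 *\<^sub>v v)))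
      + 8 * sq_norm (v - Q *\<^sub>v v)"
proof -
  let ?Qs = "map (\<lambda>P. 1\<^sub>m D - P) Ps @ [Q]"
  define w where "w = P0 *\<^sub>v v"
  define t where "t = sq_norm (v - w)"
  define x where "x = sq_norm (fold (*\<^sub>v) ?Qs v)"
  have w: "w \<in> carrier_vec D" unfolding w_def by (rule projection_vec_carrier[OF P0 v(1)])
  have Qs: "\<forall>R\<in>set ?Qs. projection D R" using Ps Q by (auto intro: projection_compl)
  have "x \<le> 1" using sq_norm_fold_projections_le[OF Qs v(1)] v(2) by (simp add: x_def)
  then have "(1 + c) * x \<le> x + c" using c by (simp add: distrib_right)
  then have perturbed: "sq_norm (fold (*\<^sub>v) ?Qs w) \<le> x + c + (1 + 1 / c) * t"
    using sq_norm_fold_projections_perturb[OF Qs v(1) w c] unfolding x_def[symmetric] t_def[symmetric]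
    by linarith
  have compl: "w - (1\<^sub>m D - P) *\<^sub>v w = P *\<^sub>v w" if "projection D P" for P
    unfolding projection_compl_vec[OF projection_carrier[OF that] w]
    using w projection_carrier[OF that] by (intro eq_vecI) auto
  have "(\<Sum>R\<leftarrow>?Qs. sq_norm (w - R *\<^sub>v w)) = (\<Sum>P\<leftarrow>Ps. sq_norm (P *\<^sub>v w)) + sq_norm (w - Q *\<^sub>v w)"
    using Ps by (simp add: compl comp_def cong: map_cong)
  then have union: "sq_norm w - sq_norm (fold (*\<^sub>v) ?Qs w)
      \<le> 4 * ((\<Sum>P\<leftarrow>Ps. sq_norm (P *\<^sub>v w)) + sq_norm (w - Q *\<^sub>v w))"
    using projections_union_bound[OF Qs w] by simp
  have miss: "sq_norm (w - Q *\<^sub>v w) \<le> 2 * sq_norm (v - Q *\<^sub>v v) + 2 * t"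
    using sq_norm_fold_projections_perturb[of "[1\<^sub>m D - Q]" D v w 1] projection_compl[OF Q] v w
    by (simp add: projection_compl_vec[OF projection_carrier[OF Q]] t_def)
  have "sq_norm w = 1 - t"
    using sq_norm_projection_compl[OF P0 v(1)] v(2) by (simp add: w_def t_def)
  moreover have "(10 + 1 / c) * t = 9 * t + (1 + 1 / c) * t" by (simp add: algebra_simps)
  ultimately show ?thesis
    using perturbed union miss unfolding x_def[symmetric] w_def[symmetric] t_def[symmetric] by argo
qed

section \<open>Mixtures of pure states\<close>

definition mixture :: "nat \<Rightarrow> ('a \<Rightarrow> real) \<Rightarrow> ('a \<Rightarrow> complex vec) \<Rightarrow> 'a set \<Rightarrow> complex mat" where
  "mixture D c u S = sum_matrix D (\<lambda>s. complex_of_real (c s) \<cdot>\<^sub>m outer (u s)) S"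

lemma mixture_carrier: "mixture D c u S \<in> carrier_mat D D"
  by (simp add: mixture_def sum_matrix_def)

lemma mixture_dim: "dim_row (mixture D c u S) = D" "dim_col (mixture D c u S) = D"
  by (simp_all add: mixture_def sum_matrix_def)

lemma mixture_index:
  assumes "\<And>s. s \<in> S \<Longrightarrow> u s \<in> carrier_vec D" "i < D" "j < D"
  shows "mixture D c u S $$ (i, j) = (\<Sum>s\<in>S. complex_of_real (c s) * (u s $ i * cnj (u s $ j)))"
proof -
  have "(complex_of_real (c s) \<cdot>\<^sub>m outer (u s)) $$ (i, j)
      = complex_of_real (c s) * (u s $ i * cnj (u s $ j))"
    if "s \<in> S" for s
    using assms(1)[OF that] assms(2,3) by (simp add: outer_def)
  then show ?thesis using assms(2,3) by (simp add: mixture_def sum_matrix_def)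
qed

lemma mixture_cong:
  assumes "\<And>s. s \<in> S \<Longrightarrow> c s = c' s" "\<And>s. s \<in> S \<Longrightarrow> u s = u' s"
  shows "mixture D c u S = mixture D c' u' S"
  using assms by (simp add: mixture_def sum_matrix_def)

lemma mixture_reindex_bij_betw:
  assumes "bij_betw h T S"
  shows "mixture D (\<lambda>t. c (h t)) (\<lambda>t. u (h t)) T = mixture D c u S"
  unfolding mixture_def sum_matrix_def
  by (intro cong_mat refl) (rule sum.reindex_bij_betw[OF assms])

lemma mixture_joint_fst:
  assumes Q: "\<And>x. x \<in> A \<Longrightarrow> distribution B (Q x)" and u: "\<And>x. x \<in> A \<Longrightarrow> u x \<in> carrier_vec D"
  shows "mixture D (joint P Q) (\<lambda>z. u (fst z)) (A \<times> B) = mixture D P u A"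
proof (rule eq_matI)
  fix i j assume "i < dim_row (mixture D P u A)" "j < dim_col (mixture D P u A)"
  then have ij: "i < D" "j < D" by (simp_all add: mixture_dim)
  have "(\<Sum>y\<in>B. complex_of_real (P x * Q x y) * b) = complex_of_real (P x) * b" if "x \<in> A" for x b
    using distributionD(3)[OF Q[OF that]]
    by (simp flip: sum_distrib_left sum_distrib_right of_real_sum)
  then show "mixture D (joint P Q) (\<lambda>z. u (fst z)) (A \<times> B) $$ (i, j) = mixture D P u A $$ (i, j)"
    using mixture_index[of "A \<times> B" "\<lambda>z. u (fst z)" D i j] mixture_index[of A u D i j] ij u
    by (auto simp: sum.cartesian_product' joint_def)
qed (simp_all add: mixture_dim)

lemma mixture_cscalar_prod:
  assumes "\<And>s. s \<in> S \<Longrightarrow> u s \<in> carrier_vec D" "v \<in> carrier_vec D" "w \<in> carrier_vec D"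
  shows "(mixture D c u S *\<^sub>v v) \<bullet>c w = (\<Sum>s\<in>S. complex_of_real (c s) * ((v \<bullet>c u s) * (u s \<bullet>c w)))"
proof -
  let ?x = "\<lambda>s i j. u s $ i * cnj (u s $ j) * v $ j * cnj (w $ i)"
  have "(mixture D c u S *\<^sub>v v) \<bullet>c w
      = (\<Sum>i\<in>{0..<D}. \<Sum>j\<in>{0..<D}. \<Sum>s\<in>S. complex_of_real (c s) * ?x s i j)"
    using assms(2,3) mixture_carrier[of D c u S]
    by (simp add: scalar_prod_def mixture_dim mixture_index[OF assms(1)] sum_distrib_right mult.assoc)
  also have "\<dots> = (\<Sum>s\<in>S. complex_of_real (c s) * (\<Sum>i\<in>{0..<D}. \<Sum>j\<in>{0..<D}. ?x s i j))"
    by (simp only: sum.swap[of _ S "{0..<D}"] sum_distrib_left)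
  also have "\<dots> = (\<Sum>s\<in>S. complex_of_real (c s) * ((v \<bullet>c u s) * (u s \<bullet>c w)))"
  proof (intro sum.cong refl)
    fix s assume "s \<in> S"
    then have "(v \<bullet>c u s) * (u s \<bullet>c w) = (\<Sum>i\<in>{0..<D}. \<Sum>j\<in>{0..<D}. ?x s i j)"
      using assms by (simp add: cscalar_prod_sum[of _ D] sum_product mult_ac) (rule sum.swap)
    then show "complex_of_real (c s) * (\<Sum>i\<in>{0..<D}. \<Sum>j\<in>{0..<D}. ?x s i j)
        = complex_of_real (c s) * ((v \<bullet>c u s) * (u s \<bullet>c w))"
      by simp
  qed
  finally show ?thesis .
qed

lemma mat_adjoint_mixture:
  assumes "\<And>s. s \<in> S \<Longrightarrow> u s \<in> carrier_vec D"
  shows "mat_adjoint (mixture D c u S) = mixture D c u S"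
  by (rule eq_matI)
    (auto simp: mat_adjoint_index mat_adjoint_dim mixture_dim mixture_index[OF assms] mult_ac)

lemma mtrace_mixture:
  assumes "\<And>s. s \<in> S \<Longrightarrow> u s \<in> carrier_vec D"
  shows "mtrace (mixture D c u S) = complex_of_real (\<Sum>s\<in>S. c s * sq_norm (u s))"
proof -
  have "mtrace (mixture D c u S) = (\<Sum>i\<in>{0..<D}. \<Sum>s\<in>S. complex_of_real (c s) * (u s $ i * cnj (u s $ i)))"
    by (simp add: mtrace_def mixture_dim mixture_index[OF assms] atLeast0LessThan)
  also have "\<dots> = (\<Sum>s\<in>S. complex_of_real (c s) * (u s \<bullet>c u s))"
    using assms
    by (subst sum.swap) (auto simp: cscalar_prod_sum[of _ D] sum_distrib_left intro!: sum.cong)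
  finally show ?thesis by (simp add: cscalar_prod_self)
qed

lemma mixture_conj:
  assumes L: "L \<in> carrier_mat m D" and u: "\<And>s. s \<in> S \<Longrightarrow> u s \<in> carrier_vec D"
  shows "L * mixture D c u S * mat_adjoint L = mixture m c (\<lambda>s. L *\<^sub>v u s) S"
proof (rule mat_eqI_cscalar_prod)
  note M = mixture_carrier[of D c u S] and L' = mat_adjoint_carrier[OF L]
  show "L * mixture D c u S * mat_adjoint L \<in> carrier_mat m m" using L M L' by simp
  show "mixture m c (\<lambda>s. L *\<^sub>v u s) S \<in> carrier_mat m m" by (rule mixture_carrier)
  fix v w :: "complex vec" assume v: "v \<in> carrier_vec m" and w: "w \<in> carrier_vec m"
  have Lu: "L *\<^sub>v u s \<in> carrier_vec m" if "s \<in> S" for s using L u[OF that] by simp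
  have "(L * mixture D c u S * mat_adjoint L) *\<^sub>v v = L *\<^sub>v (mixture D c u S *\<^sub>v (mat_adjoint L *\<^sub>v v))"
    using L M L' v assoc_mult_mat_vec[of "L * mixture D c u S" m D "mat_adjoint L" m v] by simp
  then have "((L * mixture D c u S * mat_adjoint L) *\<^sub>v v) \<bullet>c w
      = (mixture D c u S *\<^sub>v (mat_adjoint L *\<^sub>v v)) \<bullet>c (mat_adjoint L *\<^sub>v w)"
    using cscalar_prod_mat_adjoint[OF L _ w] M L' v by simp
  also have "\<dots> = (\<Sum>s\<in>S. complex_of_real (c s)
        * (((mat_adjoint L *\<^sub>v v) \<bullet>c u s) * (u s \<bullet>c (mat_adjoint L *\<^sub>v w))))"
    using mixture_cscalar_prod[OF u, where v = "mat_adjoint L *\<^sub>v v" and w = "mat_adjoint L *\<^sub>v w"] L' v w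
    by simp
  also have "\<dots> = (\<Sum>s\<in>S. complex_of_real (c s) * ((v \<bullet>c (L *\<^sub>v u s)) * ((L *\<^sub>v u s) \<bullet>c w)))"
  proof (intro sum.cong refl)
    fix s assume s: "s \<in> S"
    have "(mat_adjoint L *\<^sub>v v) \<bullet>c u s = cnj (u s \<bullet>c (mat_adjoint L *\<^sub>v v))"
      using cnj_cscalar_prod[OF u[OF s], of "mat_adjoint L *\<^sub>v v"] L' v by simp
    also have "\<dots> = v \<bullet>c (L *\<^sub>v u s)"
      using cscalar_prod_mat_adjoint[OF L u[OF s] v] cnj_cscalar_prod[OF Lu[OF s] v] by simp
    finally show "complex_of_real (c s)
          * (((mat_adjoint L *\<^sub>v v) \<bullet>c u s) * (u s \<bullet>c (mat_adjoint L *\<^sub>v w)))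
      = complex_of_real (c s) * ((v \<bullet>c (L *\<^sub>v u s)) * ((L *\<^sub>v u s) \<bullet>c w))"
      using cscalar_prod_mat_adjoint[OF L u[OF s] w] by simp
  qed
  also have "\<dots> = (mixture m c (\<lambda>s. L *\<^sub>v u s) S *\<^sub>v v) \<bullet>c w"
    by (rule mixture_cscalar_prod[OF Lu v w, symmetric])
  finally show "((L * mixture D c u S * mat_adjoint L) *\<^sub>v v) \<bullet>c w
      = (mixture m c (\<lambda>s. L *\<^sub>v u s) S *\<^sub>v v) \<bullet>c w" .
qed

lemma mtrace_mixture_conj:
  assumes "L \<in> carrier_mat m D" "\<And>s. s \<in> S \<Longrightarrow> u s \<in> carrier_vec D"
  shows "mtrace (L * mixture D c u S * mat_adjoint L)
      = complex_of_real (\<Sum>s\<in>S. c s * sq_norm (L *\<^sub>v u s))"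
  using mixture_conj[OF assms, where c = c] mtrace_mixture[of S "\<lambda>s. L *\<^sub>v u s" m c] assms by simp

lemma mixture_eq_imp_sq_norm_sum_eq:
  assumes "mixture D c u S = mixture D r f T"
    and "\<And>s. s \<in> S \<Longrightarrow> u s \<in> carrier_vec D" "\<And>t. t \<in> T \<Longrightarrow> f t \<in> carrier_vec D" "L \<in> carrier_mat m D"
  shows "(\<Sum>s\<in>S. c s * sq_norm (L *\<^sub>v u s)) = (\<Sum>t\<in>T. r t * sq_norm (L *\<^sub>v f t))"
  using mtrace_mixture_conj[where S = S and u = u and c = c, OF assms(4,2)]
    mtrace_mixture_conj[where S = T and u = f and c = r, OF assms(4,3)] assms(1)
  by (simp only: of_real_eq_iff)

lemma Re_mixture_cscalar_prod_self:
  assumes u: "\<And>s. s \<in> S \<Longrightarrow> u s \<in> carrier_vec D" and v: "v \<in> carrier_vec D"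
  shows "Re ((mixture D c u S *\<^sub>v v) \<bullet>c v) = (\<Sum>s\<in>S. c s * (cmod (v \<bullet>c u s))\<^sup>2)"
proof -
  have "(v \<bullet>c u s) * (u s \<bullet>c v) = complex_of_real ((cmod (v \<bullet>c u s))\<^sup>2)" if "s \<in> S" for s
    unfolding cnj_cscalar_prod[OF v u[OF that], symmetric] by (rule complex_norm_square[symmetric])
  then have "(mixture D c u S *\<^sub>v v) \<bullet>c v = complex_of_real (\<Sum>s\<in>S. c s * (cmod (v \<bullet>c u s))\<^sup>2)"
    using mixture_cscalar_prod[of S u D v v c] u v by simp
  then show ?thesis by (simp only: Re_complex_of_real)
qed

definition orthonormal_on :: "nat \<Rightarrow> ('a \<Rightarrow> complex vec) \<Rightarrow> 'a set \<Rightarrow> bool" where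
  "orthonormal_on D u S \<longleftrightarrow> (\<forall>s\<in>S. u s \<in> carrier_vec D) \<and>
     (\<forall>s\<in>S. \<forall>t\<in>S. u s \<bullet>c u t = (if s = t then 1 else 0))"

lemma orthonormal_onD:
  assumes "orthonormal_on D u S" "s \<in> S"
  shows "u s \<in> carrier_vec D" "t \<in> S \<Longrightarrow> u s \<bullet>c u t = (if s = t then 1 else 0)"
  using assms by (auto simp: orthonormal_on_def)

lemma orthonormal_on_subset: "orthonormal_on D u S \<Longrightarrow> T \<subseteq> S \<Longrightarrow> orthonormal_on D u T"
  unfolding orthonormal_on_def by blast

lemma orthonormal_on_reindex:
  assumes "bij_betw h T S" "orthonormal_on D (\<lambda>t. u (h t)) T"
  shows "orthonormal_on D u S"
proof -
  have "S = h ` T" "inj_on h T" using assms(1) by (simp_all add: bij_betw_def)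
  then show ?thesis using assms(2) by (auto simp: orthonormal_on_def inj_on_eq_iff)
qed

lemma sq_norm_orthonormal_on: "orthonormal_on D u S \<Longrightarrow> s \<in> S \<Longrightarrow> sq_norm (u s) = 1"
  by (simp add: sq_norm_def orthonormal_onD(2))

lemma mixture_eigenvector:
  assumes "finite S" "orthonormal_on D u S" "s \<in> S"
  shows "mixture D c u S *\<^sub>v u s = complex_of_real (c s) \<cdot>\<^sub>v u s"
proof -
  note u = orthonormal_onD[OF assms(2)]
  let ?x = "mixture D c u S *\<^sub>v u s" and ?y = "complex_of_real (c s) \<cdot>\<^sub>v u s"
  have x: "?x \<in> carrier_vec D" and y: "?y \<in> carrier_vec D"
    using u(1)[OF assms(3)] mixture_carrier[of D c u S] by auto
  have "?x \<bullet>c w = ?y \<bullet>c w" if w: "w \<in> carrier_vec D" for w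
  proof -
    have "?x \<bullet>c w = (\<Sum>t\<in>S. complex_of_real (c t) * ((u s \<bullet>c u t) * (u t \<bullet>c w)))"
      by (rule mixture_cscalar_prod[OF u(1) u(1)[OF assms(3)] w])
    also have "\<dots> = (\<Sum>t\<in>S. if t = s then complex_of_real (c s) * (u s \<bullet>c w) else 0)"
      using u(2)[OF assms(3)] by (intro sum.cong) auto
    finally show ?thesis using assms(1,3) cscalar_prod_smult(1)[OF u(1)[OF assms(3)] w] by simp
  qed
  then have "sq_norm (?x - ?y) = 0"
    using x y by (simp add: sq_norm_def cscalar_prod_minus_left[of _ D])
  then have diff: "?x - ?y = 0\<^sub>v D" using x y sq_norm_eq_0_iff[of "?x - ?y" D] by simp
  have "?x = ?y + (?x - ?y)" using x y by (intro eq_vecI) (auto simp: mixture_dim)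
  then show ?thesis using y by (simp add: diff)
qed

lemma distribution_eigenvalues:
  assumes u: "orthonormal_on D u S" and "finite S"
    and pos: "\<And>v. v \<in> carrier_vec D \<Longrightarrow> 0 \<le> Re ((mixture D c u S *\<^sub>v v) \<bullet>c v)"
    and trace: "mtrace (mixture D c u S) = 1"
  shows "distribution S c"
  unfolding distribution_def
proof (intro conjI ballI)
  note uc = orthonormal_onD(1)[OF u]
  show "0 \<le> c s" if s: "s \<in> S" for s
    using pos[OF uc[OF s]] uc[OF s] orthonormal_onD(2)[OF u s s]
    by (simp add: mixture_eigenvector[OF \<open>finite S\<close> u s] cscalar_prod_smult(1)[of _ D])
  have "complex_of_real (\<Sum>s\<in>S. c s * sq_norm (u s)) = 1"
    using trace mtrace_mixture[of S u D c] uc by simp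
  then show "sum c S = 1" by (simp only: of_real_eq_1_iff) (simp add: sq_norm_orthonormal_on[OF u])
qed (rule \<open>finite S\<close>)

definition span_proj :: "nat \<Rightarrow> ('a \<Rightarrow> complex vec) \<Rightarrow> 'a set \<Rightarrow> complex mat" where
  "span_proj D u S = mixture D (\<lambda>_. 1) u S"

lemma span_proj_basis:
  assumes "finite S" "orthonormal_on D u S" "s \<in> S"
  shows "span_proj D u S *\<^sub>v u s = u s"
  using mixture_eigenvector[OF assms, of "\<lambda>_. 1"] by (simp add: span_proj_def)

lemma span_proj_cscalar_prod:
  assumes "orthonormal_on D u S" "v \<in> carrier_vec D" "w \<in> carrier_vec D"
  shows "(span_proj D u S *\<^sub>v v) \<bullet>c w = (\<Sum>s\<in>S. (v \<bullet>c u s) * (u s \<bullet>c w))"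
  using mixture_cscalar_prod[OF orthonormal_onD(1)[OF assms(1)] assms(2,3), where c = "\<lambda>_. 1"]
  by (simp add: span_proj_def)

lemma projection_span_proj:
  assumes "finite S" "orthonormal_on D u S"
  shows "projection D (span_proj D u S)"
proof -
  let ?P = "span_proj D u S"
  note u = orthonormal_onD(1)[OF assms(2)]
  have P: "?P \<in> carrier_mat D D" and adj: "mat_adjoint ?P = ?P"
    unfolding span_proj_def by (rule mixture_carrier, rule mat_adjoint_mixture[OF u])
  have "?P * ?P = ?P"
  proof (rule mat_eqI_cscalar_prod[OF _ P])
    show "?P * ?P \<in> carrier_mat D D" using P by simp
    fix v w :: "complex vec" assume v: "v \<in> carrier_vec D" and w: "w \<in> carrier_vec D"
    have "(?P *\<^sub>v v) \<bullet>c u s = v \<bullet>c u s" if "s \<in> S" for s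
      using cscalar_prod_mat_adjoint[OF P v u[OF that]] by (simp add: adj span_proj_basis[OF assms that])
    then have "(?P *\<^sub>v (?P *\<^sub>v v)) \<bullet>c w = (?P *\<^sub>v v) \<bullet>c w"
      using P v w by (simp add: span_proj_cscalar_prod[OF assms(2)])
    then show "((?P * ?P) *\<^sub>v v) \<bullet>c w = (?P *\<^sub>v v) \<bullet>c w" using P v by simp
  qed
  then show ?thesis using P adj by (simp add: projection_def)
qed

lemma sq_norm_span_proj:
  assumes "finite S" "orthonormal_on D u S" "v \<in> carrier_vec D"
  shows "sq_norm (span_proj D u S *\<^sub>v v) = (\<Sum>s\<in>S. (cmod (v \<bullet>c u s))\<^sup>2)"
proof -
  note P = projection_span_proj[OF assms(1,2)]
  have "sq_norm (span_proj D u S *\<^sub>v v) = Re ((span_proj D u S *\<^sub>v v) \<bullet>c v)"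
    using projection_cscalar_prod[OF P assms(3,3)] by (simp add: sq_norm_def)
  also have "\<dots> = (\<Sum>s\<in>S. (cmod (v \<bullet>c u s))\<^sup>2)"
    using Re_mixture_cscalar_prod_self[of S u D v "\<lambda>_. 1"] orthonormal_onD(1)[OF assms(2)] assms(3)
    by (simp add: span_proj_def)
  finally show ?thesis .
qed

lemma span_proj_orthogonal_basis:
  assumes "finite S" "orthonormal_on D u T" "S \<subseteq> T" "t \<in> T - S"
  shows "span_proj D u S *\<^sub>v u t = 0\<^sub>v D"
proof -
  have u: "orthonormal_on D u S" "u t \<in> carrier_vec D"
    using orthonormal_on_subset[OF assms(2,3)] orthonormal_onD(1)[OF assms(2)] assms(4) by auto
  have "u t \<bullet>c u s = 0" if "s \<in> S" for s
    using orthonormal_onD(2)[OF assms(2), of t s] assms(3,4) that by auto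
  then have "sq_norm (span_proj D u S *\<^sub>v u t) = 0"
    by (simp add: sq_norm_span_proj[OF assms(1) u])
  then show ?thesis
    using sq_norm_eq_0_iff[OF projection_vec_carrier[OF projection_span_proj[OF assms(1) u(1)] u(2)]]
    by simp
qed

lemma bessel_inequality:
  assumes "finite S" "orthonormal_on D u S" "v \<in> carrier_vec D"
  shows "(\<Sum>s\<in>S. (cmod (v \<bullet>c u s))\<^sup>2) \<le> sq_norm v"
  using sq_norm_span_proj[OF assms]
    sq_norm_projection_le[OF projection_span_proj[OF assms(1,2)] assms(3)] by simp

lemma sum_sq_norm_span_proj_le_card:
  assumes "finite S" "orthonormal_on D u S" "finite T" "orthonormal_on D b T"
  shows "(\<Sum>t\<in>T. sq_norm (span_proj D u S *\<^sub>v b t)) \<le> real (card S)"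
proof -
  note u = orthonormal_onD(1)[OF assms(2)] and b = orthonormal_onD(1)[OF assms(4)]
  have "(\<Sum>t\<in>T. sq_norm (span_proj D u S *\<^sub>v b t)) = (\<Sum>t\<in>T. \<Sum>s\<in>S. (cmod (b t \<bullet>c u s))\<^sup>2)"
    by (intro sum.cong refl sq_norm_span_proj[OF assms(1,2)] b)
  also have "\<dots> = (\<Sum>s\<in>S. \<Sum>t\<in>T. (cmod (u s \<bullet>c b t))\<^sup>2)"
    by (subst sum.swap, intro sum.cong refl)
      (metis cnj_cscalar_prod[OF u b] complex_mod_cnj)
  also have "\<dots> \<le> (\<Sum>s\<in>S. sq_norm (u s))"
    by (intro sum_mono bessel_inequality[OF assms(3,4)] u)
  finally show ?thesis by (simp add: sq_norm_orthonormal_on[OF assms(2)])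
qed

section \<open>Spectral decomposition and von Neumann entropy\<close>

lemma mat_of_cols_orthonormal_on:
  assumes "orthonormal_on D u {0..<D}"
  defines "U \<equiv> mat_of_cols D (map u [0..<D])"
  shows "mat_adjoint U * U = 1\<^sub>m D" "U * mat_adjoint U = 1\<^sub>m D"
proof -
  have U: "U \<in> carrier_mat D D" by (simp add: U_def carrier_matI)
  show "mat_adjoint U * U = 1\<^sub>m D"
  proof (rule eq_matI)
    fix i j assume "i < dim_row (1\<^sub>m D :: complex mat)" "j < dim_col (1\<^sub>m D :: complex mat)"
    then have ij: "i < D" "j < D" by auto
    then have "u i \<in> carrier_vec D" "u j \<in> carrier_vec D" using orthonormal_onD(1)[OF assms(1)] by auto
    moreover have "(mat_adjoint U * U) $$ (i, j) = (\<Sum>l\<in>{0..<D}. cnj (u i $ l) * u j $ l)"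
      using ij U
      by (auto simp: scalar_prod_def mat_adjoint_index mat_adjoint_dim U_def mat_of_cols_index)
    ultimately have "(mat_adjoint U * U) $$ (i, j) = u j \<bullet>c u i"
      by (simp add: cscalar_prod_sum[of _ D] mult.commute)
    then show "(mat_adjoint U * U) $$ (i, j) = 1\<^sub>m D $$ (i, j)"
      using orthonormal_onD(2)[OF assms(1)] ij by simp
  qed (use U in \<open>simp_all add: mat_adjoint_dim\<close>)
  then show "U * mat_adjoint U = 1\<^sub>m D"
    by (rule mat_mult_left_right_inverse[OF mat_adjoint_carrier[OF U] U])
qed

lemma mixture_eq_unitary_conj_diag:
  assumes "\<And>i. i < D \<Longrightarrow> u i \<in> carrier_vec D"
  defines "U \<equiv> mat_of_cols D (map u [0..<D])"
  shows "mixture D c u {0..<D} = U * mat_diag D (\<lambda>i. complex_of_real (c i)) * mat_adjoint U"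
proof -
  have U: "U \<in> carrier_mat D D" by (simp add: U_def carrier_matI)
  show ?thesis
    unfolding mat_diag_mult_right[OF U]
    using U mixture_index[of "{0..<D}" u D _ _ c] assms(1)
    by (intro eq_matI) (auto simp: mixture_dim mat_adjoint_dim mat_adjoint_index scalar_prod_def
        U_def mat_of_cols_index mult_ac intro!: sum.cong)
qed

lemma proots_prod_linear: "proots (\<Prod>a\<leftarrow>as. [:- a, 1:]) = mset as" for as :: "'a :: idom list"
proof -
  have "0 \<notin> set (map (\<lambda>a. [:- a, 1:]) as)" by auto
  moreover have "(\<Sum>a\<leftarrow>as. {#a#}) = mset as" by (induction as) simp_all
  ultimately show ?thesis using proots_prod_list[of "map (\<lambda>a. [:- a, 1:]) as"] by (simp add: comp_def)
qed

lemma vn_entropy_mixture: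
  assumes "finite S" "orthonormal_on D u S" "card S = D"
  shows "vn_entropy (mixture D c u S) = shannon_entropy S c"
proof -
  obtain h where h: "bij_betw h {0..<D} S" using ex_bij_betw_nat_finite[OF assms(1)] assms(3) by blast
  define v where "v i = u (h i)" for i
  define r where "r i = c (h i)" for i
  have hS: "h i \<in> S" if "i < D" for i using bij_betwE[OF h] that by auto
  have "orthonormal_on D v {0..<D}"
    using assms(2) hS bij_betw_imp_inj_on[OF h] by (auto simp: orthonormal_on_def v_def inj_on_eq_iff)
  note v = orthonormal_onD(1)[OF this] and unitary = mat_of_cols_orthonormal_on[OF this]
  let ?U = "mat_of_cols D (map v [0..<D])" and ?B = "mat_diag D (\<lambda>i. complex_of_real (r i))"
  let ?A = "mixture D c u S"
  have U: "?U \<in> carrier_mat D D" by (simp add: carrier_matI)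
  have "?A = ?U * ?B * mat_adjoint ?U"
    using mixture_eq_unitary_conj_diag[of D v r] v mixture_reindex_bij_betw[OF h, of D c u]
    by (simp add: v_def[abs_def] r_def[abs_def])
  then have "similar_mat ?A ?B"
    using unitary U mat_adjoint_carrier[OF U] mixture_carrier
    by (intro similar_matI[of _ _ ?U "mat_adjoint ?U" D]) auto
  then have "char_poly ?A = (\<Prod>a\<leftarrow>diag_mat ?B. [:- a, 1:])"
    using char_poly_upper_triangular[of ?B D]
    by (simp add: char_poly_similar upper_triangular_def mat_diag_def)
  also have "diag_mat ?B = map (\<lambda>i. complex_of_real (r i)) [0..<D]"
    by (auto simp: diag_mat_def mat_diag_def)
  finally have "proots (char_poly ?A) = image_mset (\<lambda>i. complex_of_real (r i)) (mset [0..<D])"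
    by (simp only: proots_prod_linear mset_map)
  then have "vn_entropy ?A = - (\<Sum>i\<leftarrow>[0..<D]. r i * log 2 (r i))"
    by (simp add: vn_entropy_def multiset.map_comp comp_def flip: sum_mset_sum_list)
  also have "(\<Sum>i\<leftarrow>[0..<D]. r i * log 2 (r i)) = (\<Sum>i\<in>{0..<D}. r i * log 2 (r i))"
    by (simp add: sum_list_distinct_conv_sum_set)
  also have "\<dots> = (\<Sum>s\<in>S. c s * log 2 (c s))"
    unfolding r_def by (rule sum.reindex_bij_betw[OF h])
  finally show ?thesis by (simp add: shannon_entropy_def)
qed

lemma mtrace_mult_comm:
  assumes "A \<in> carrier_mat m n" "B \<in> carrier_mat n m"
  shows "mtrace (A * B) = mtrace (B * A)"
proof -
  have "mtrace (A * B) = (\<Sum>i\<in>{0..<m}. \<Sum>j\<in>{0..<n}. A $$ (i, j) * B $$ (j, i))"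
    using assms by (auto simp: mtrace_def scalar_prod_def atLeast0LessThan)
  also have "\<dots> = mtrace (B * A)"
    using assms by (subst sum.swap) (auto simp: mtrace_def scalar_prod_def atLeast0LessThan mult.commute)
  finally show ?thesis .
qed

lemma mtrace_add: "A \<in> carrier_mat D D \<Longrightarrow> B \<in> carrier_mat D D \<Longrightarrow> mtrace (A + B) = mtrace A + mtrace B"
  by (simp add: mtrace_def sum.distrib)

lemma mtrace_eq_sum_list_eigenvalues:
  assumes A: "A \<in> carrier_mat D D" and es: "char_poly A = (\<Prod>a\<leftarrow>es. [:- a, 1:])"
  shows "mtrace A = sum_list es"
proof -
  obtain B P Q where schur: "schur_decomposition A es = (B, P, Q)" by (metis prod_cases3)
  then have "similar_mat_wit A B P Q" and diag: "diag_mat B = es"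
    using schur_decomposition[OF A es] by blast+
  note wit = similar_mat_witD2[OF A this(1)]
  have "mtrace A = mtrace (P * (B * Q))" using wit by simp
  also have "\<dots> = mtrace (B * Q * P)" using wit by (intro mtrace_mult_comm[of _ D D]) auto
  also have "B * Q * P = B" using wit by simp
  finally have "mtrace A = mtrace B" .
  also have "\<dots> = sum_list (diag_mat B)"
    by (simp add: mtrace_def diag_mat_def sum_list_distinct_conv_sum_set atLeast0LessThan)
  finally show ?thesis by (simp add: diag)
qed

lemma exists_eigenvalue_neq:
  assumes A: "A \<in> carrier_mat D D" and "mtrace A \<noteq> of_nat D * c"
  shows "\<exists>l. eigenvalue A l \<and> l \<noteq> c"
proof -
  obtain es where es: "char_poly A = (\<Prod>a\<leftarrow>es. [:- a, 1:])" "length es = D"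
    using char_poly_factorized[OF A] by blast
  have "\<exists>l\<in>set es. l \<noteq> c"
  proof (rule ccontr)
    assume "\<not> (\<exists>l\<in>set es. l \<noteq> c)"
    then have "es = replicate D c" using es(2) by (metis replicate_eqI)
    then show False
      using assms(2) mtrace_eq_sum_list_eigenvalues[OF A es(1)] by (simp add: sum_list_replicate)
  qed
  then obtain l where "l \<in> set es" "l \<noteq> c" by blast
  then show ?thesis using eigenvalue_root_char_poly[OF A] es(1) by (auto simp: poly_prod_list_zero_iff)
qed

lemma hermitian_eigenvalue_real:
  assumes "A \<in> carrier_mat D D" "mat_adjoint A = A"
    and "v \<in> carrier_vec D" "v \<noteq> 0\<^sub>v D" "A *\<^sub>v v = l \<cdot>\<^sub>v v"
  shows "l = complex_of_real (Re l)"
proof -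
  have "l * (v \<bullet>c v) = (A *\<^sub>v v) \<bullet>c v" using assms(3,5) by (simp add: cscalar_prod_smult(1)[of _ D])
  also have "\<dots> = v \<bullet>c (A *\<^sub>v v)" using cscalar_prod_mat_adjoint[OF assms(1,3,3)] assms(2) by simp
  also have "\<dots> = cnj l * (v \<bullet>c v)" using assms(3,5) by (simp add: cscalar_prod_smult(2)[of _ D])
  finally have "l = cnj l" using conjugate_square_eq_0_vec[OF assms(3)] assms(4) by simp
  then show ?thesis by (simp add: complex_eq_iff)
qed

lemma deflated_eigenvector:
  assumes A: "A \<in> carrier_mat D D" "mat_adjoint A = A"
    and f: "finite S" "orthonormal_on D f S"
    and eig: "\<And>t. t \<in> S \<Longrightarrow> A *\<^sub>v f t = complex_of_real (r t) \<cdot>\<^sub>v f t"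
    and v: "v \<in> carrier_vec D" and "l \<noteq> complex_of_real c"
    and deflated: "(A + mixture D (\<lambda>t. c - r t) f S) *\<^sub>v v = l \<cdot>\<^sub>v v"
  shows "t \<in> S \<Longrightarrow> v \<bullet>c f t = 0" "A *\<^sub>v v = l \<cdot>\<^sub>v v"
proof -
  let ?M = "mixture D (\<lambda>t. c - r t) f S"
  note fc = orthonormal_onD(1)[OF f(2)]
  have M: "?M \<in> carrier_mat D D" and adj: "mat_adjoint ?M = ?M"
    by (rule mixture_carrier, rule mat_adjoint_mixture[OF fc])
  have Av: "A *\<^sub>v v \<in> carrier_vec D" and Mv: "?M *\<^sub>v v \<in> carrier_vec D" using A(1) M v by auto
  have sum: "A *\<^sub>v v + ?M *\<^sub>v v = l \<cdot>\<^sub>v v"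
    using A(1) M v deflated by (simp add: add_mult_distrib_mat_vec[of _ D D])
  show orth: "v \<bullet>c f t = 0" if t: "t \<in> S" for t
  proof -
    note ft = fc[OF t]
    have "(A *\<^sub>v v) \<bullet>c f t = complex_of_real (r t) * (v \<bullet>c f t)"
      using cscalar_prod_mat_adjoint[OF A(1) v ft] A(2) eig[OF t] cscalar_prod_smult(2)[OF v ft]
      by simp
    moreover have "(?M *\<^sub>v v) \<bullet>c f t = complex_of_real (c - r t) * (v \<bullet>c f t)"
      using cscalar_prod_mat_adjoint[OF M v ft] mixture_eigenvector[OF f t]
        cscalar_prod_smult(2)[OF v ft] by (simp add: adj)
    moreover have "l * (v \<bullet>c f t) = (A *\<^sub>v v) \<bullet>c f t + (?M *\<^sub>v v) \<bullet>c f t"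
      using cscalar_prod_smult(1)[OF v ft, of l] Av Mv ft
      by (simp add: add_scalar_prod_distrib[of _ D] flip: sum)
    ultimately have "(l - complex_of_real c) * (v \<bullet>c f t) = 0" by (simp add: algebra_simps)
    then show ?thesis using \<open>l \<noteq> complex_of_real c\<close> by simp
  qed
  have "(?M *\<^sub>v v) \<bullet>c (?M *\<^sub>v v) = 0"
    using mixture_cscalar_prod[of S f D v "?M *\<^sub>v v" "\<lambda>t. c - r t"] fc v Mv orth by simp
  then have "?M *\<^sub>v v = 0\<^sub>v D" using conjugate_square_eq_0_vec[OF Mv] by simp
  then show "A *\<^sub>v v = l \<cdot>\<^sub>v v" using sum Av by simp
qed

text \<open>
  Deflation: adding the mixture of weights \<open>c - r t\<close> turns all known eigenvalues into \<open>c\<close>. For a \<open>c\<close>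
  that the trace excludes as the only eigenvalue, any other eigenvalue has an eigenvector orthogonal
  to all \<open>f t\<close>.
\<close>
lemma hermitian_orthogonal_eigenvector:
  assumes A: "A \<in> carrier_mat D D" "mat_adjoint A = A"
    and f: "finite S" "orthonormal_on D f S"
    and eig: "\<And>t. t \<in> S \<Longrightarrow> A *\<^sub>v f t = complex_of_real (r t) \<cdot>\<^sub>v f t" and "card S < D"
  shows "\<exists>v l. v \<in> carrier_vec D \<and> v \<noteq> 0\<^sub>v D \<and> A *\<^sub>v v = l \<cdot>\<^sub>v v \<and> (\<forall>t\<in>S. v \<bullet>c f t = 0)"
proof -
  define c where "c = (Re (mtrace A) - (\<Sum>t\<in>S. r t) + 1) / (real D - real (card S))"
  let ?M = "mixture D (\<lambda>t. c - r t) f S"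
  note M = mixture_carrier[of D "\<lambda>t. c - r t" f S]
  have "mtrace ?M = complex_of_real (\<Sum>t\<in>S. c - r t)"
    using mtrace_mixture[of S f D "\<lambda>t. c - r t"] orthonormal_onD(1)[OF f(2)]
      sq_norm_orthonormal_on[OF f(2)] by simp
  then have "Re (mtrace (A + ?M)) = Re (mtrace A) + real (card S) * c - (\<Sum>t\<in>S. r t)"
    by (simp add: mtrace_add[OF A(1) M] sum_subtractf)
  also have "\<dots> = real D * c - 1"
    using \<open>card S < D\<close> by (simp add: c_def field_simps)
  finally have "mtrace (A + ?M) \<noteq> of_nat D * complex_of_real c" by (auto simp: complex_eq_iff)
  then obtain l v where "l \<noteq> complex_of_real c" "eigenvector (A + ?M) v l"
    using exists_eigenvalue_neq[of "A + ?M" D "complex_of_real c"] A(1) M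
    by (auto simp: eigenvalue_def)
  moreover from this have "v \<in> carrier_vec D" "v \<noteq> 0\<^sub>v D" "(A + ?M) *\<^sub>v v = l \<cdot>\<^sub>v v"
    using A(1) M by (auto simp: eigenvector_def)
  ultimately show ?thesis using deflated_eigenvector[OF A f eig, of v l c] by blast
qed

lemma hermitian_eigenbasis:
  assumes A: "A \<in> carrier_mat D D" "mat_adjoint A = A" and "m \<le> D"
  shows "\<exists>f r. orthonormal_on D f {0..<m} \<and> (\<forall>t<m. A *\<^sub>v f t = complex_of_real (r t) \<cdot>\<^sub>v f t)"
  using assms(3)
proof (induction m)
  case 0
  then show ?case by (simp add: orthonormal_on_def)
next
  case (Suc m)
  then obtain f and r :: "nat \<Rightarrow> real" where f: "orthonormal_on D f {0..<m}"
    and eig: "\<And>t. t < m \<Longrightarrow> A *\<^sub>v f t = complex_of_real (r t) \<cdot>\<^sub>v f t" by auto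
  have fc: "f t \<in> carrier_vec D" if "t < m" for t using orthonormal_onD(1)[OF f] that by simp
  obtain v l where v: "v \<in> carrier_vec D" "v \<noteq> 0\<^sub>v D" and Av: "A *\<^sub>v v = l \<cdot>\<^sub>v v"
    and orth: "\<And>t. t < m \<Longrightarrow> v \<bullet>c f t = 0"
    using hermitian_orthogonal_eigenvector[OF A _ f, of r] eig Suc.prems by auto
  define b where "b = complex_of_real (1 / sqrt (sq_norm v))"
  define g where "g = b \<cdot>\<^sub>v v"
  have g: "g \<in> carrier_vec D" using v by (simp add: g_def)
  have "0 < sq_norm v" using sq_norm_nonneg[of v] sq_norm_eq_0_iff[OF v(1)] v(2) by simp
  then have "sq_norm g = 1" by (simp add: g_def sq_norm_smult[OF v(1)] b_def norm_divide power_divide)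
  then have "g \<bullet>c g = 1" by (simp add: cscalar_prod_self)
  moreover have "g \<bullet>c f t = 0 \<and> f t \<bullet>c g = 0" if "t < m" for t
    using cscalar_prod_smult[OF v(1) fc[OF that], of b] cnj_cscalar_prod[OF g fc[OF that]] orth[OF that]
    by (simp add: g_def)
  ultimately have "orthonormal_on D (f(m := g)) {0..<Suc m}"
    using f g by (auto simp: orthonormal_on_def less_Suc_eq)
  moreover have "A *\<^sub>v g = complex_of_real (Re l) \<cdot>\<^sub>v g"
    using hermitian_eigenvalue_real[OF A v Av] A(1) v(1)
    by (simp add: g_def mult_mat_vec[of A D D] Av smult_smult_assoc mult.commute)
  then have "\<forall>t<Suc m. A *\<^sub>v (f(m := g)) t = complex_of_real ((r(m := Re l)) t) \<cdot>\<^sub>v (f(m := g)) t"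
    using eig by (auto simp: less_Suc_eq)
  ultimately show ?case by blast
qed

theorem hermitian_spectral_decomposition:
  assumes A: "A \<in> carrier_mat D D" "mat_adjoint A = A"
  obtains f r where "orthonormal_on D f {0..<D}" "A = mixture D r f {0..<D}"
proof -
  obtain f and r :: "nat \<Rightarrow> real" where f: "orthonormal_on D f {0..<D}"
    and eig: "\<And>t. t < D \<Longrightarrow> A *\<^sub>v f t = complex_of_real (r t) \<cdot>\<^sub>v f t"
    using hermitian_eigenbasis[OF A order_refl] by blast
  let ?U = "mat_of_cols D (map f [0..<D])" and ?M = "mixture D r f {0..<D}"
  have U: "?U \<in> carrier_mat D D" by (simp add: carrier_matI)
  note M = mixture_carrier[of D r f "{0..<D}"] and U' = mat_adjoint_carrier[OF U]
  have "A * ?U = ?M * ?U"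
  proof (rule mat_col_eqI)
    fix j assume "j < dim_col (?M * ?U)"
    then have j: "j < D" by simp
    have "col ?U j = f j" using orthonormal_onD(1)[OF f] j by simp
    then show "col (A * ?U) j = col (?M * ?U) j"
      using mixture_eigenvector[OF _ f, of j r] eig[OF j] j
      by (simp add: col_mult2[OF A(1) U j] col_mult2[OF M U j])
  qed (use A(1) in \<open>simp_all add: mixture_dim\<close>)
  then have "A * (?U * mat_adjoint ?U) = ?M * (?U * mat_adjoint ?U)"
    using assoc_mult_mat[OF A(1) U U'] assoc_mult_mat[OF M U U'] by metis
  then have "A = ?M" using mat_of_cols_orthonormal_on(2)[OF f] A(1) M by simp
  then show thesis using that f by blast
qed

section \<open>Tensor products\<close>

lemma sum_div_mod:
  "(\<Sum>i<a * b. f (i div b) (i mod b)) = (\<Sum>i<a. \<Sum>j<b. f i j)" for a b :: nat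
proof -
  have "(\<Sum>i\<in>{m * b..<m * b + b}. f (i div b) (i mod b)) = (\<Sum>j<b. f m j)" for m
    using sum.shift_bounds_nat_ivl[of "\<lambda>i. f (i div b) (i mod b)" 0 "m * b" b]
    by (simp add: add.commute atLeast0LessThan)
  then show ?thesis
    by (simp flip: sum.nat_group)
qed

lemma tensor_vec_carrier:
  "u \<in> carrier_vec a \<Longrightarrow> v \<in> carrier_vec b \<Longrightarrow> tensor_vec u v \<in> carrier_vec (a * b)"
  by (auto simp: tensor_vec_def)

lemma tensor_vec_index:
  assumes "u \<in> carrier_vec a" "v \<in> carrier_vec b" "i < a * b"
  shows "tensor_vec u v $ i = u $ (i div b) * v $ (i mod b)"
  using assms by (auto simp: tensor_vec_def)

lemma block_index_less: "i < a \<Longrightarrow> j < b \<Longrightarrow> i * b + j < a * b" for a b i j :: nat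
  using mult_le_mono1[of "Suc i" a b] by simp

lemma tensor_vec_block_index:
  assumes "u \<in> carrier_vec a" "v \<in> carrier_vec b" "i < a" "j < b"
  shows "tensor_vec u v $ (i * b + j) = u $ i * v $ j"
  using assms by (simp add: tensor_vec_index block_index_less)

lemma tensor_vec_cscalar_prod:
  assumes "u \<in> carrier_vec a" "u' \<in> carrier_vec a" "v \<in> carrier_vec b" "v' \<in> carrier_vec b"
  shows "tensor_vec u v \<bullet>c tensor_vec u' v' = (u \<bullet>c u') * (v \<bullet>c v')"
proof -
  have "tensor_vec u v \<bullet>c tensor_vec u' v'
      = (\<Sum>i<a * b. (u $ (i div b) * cnj (u' $ (i div b))) * (v $ (i mod b) * cnj (v' $ (i mod b))))"
    using assms
    by (simp add: cscalar_prod_sum[OF tensor_vec_carrier tensor_vec_carrier] tensor_vec_index[of _ a _ b]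
        atLeast0LessThan mult_ac)
  also have "\<dots> = (\<Sum>i<a. \<Sum>j<b. (u $ i * cnj (u' $ i)) * (v $ j * cnj (v' $ j)))"
    by (rule sum_div_mod)
  finally show ?thesis
    using assms
    by (simp add: cscalar_prod_sum[of _ a] cscalar_prod_sum[of _ b] sum_product atLeast0LessThan)
qed

lemma orthonormal_on_tensor_vec:
  assumes u: "orthonormal_on a u A" and v: "\<And>x. x \<in> A \<Longrightarrow> orthonormal_on b (v x) B"
  shows "orthonormal_on (a * b) (\<lambda>(x, y). tensor_vec (u x) (v x y)) (A \<times> B)"
  unfolding orthonormal_on_def
proof (intro conjI ballI)
  fix z assume "z \<in> A \<times> B"
  then obtain x y where z: "z = (x, y)" "x \<in> A" "y \<in> B" by auto
  note carrier_z = orthonormal_onD(1)[OF u z(2)] orthonormal_onD(1)[OF v[OF z(2)] z(3)]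
  then show "(case z of (x, y) \<Rightarrow> tensor_vec (u x) (v x y)) \<in> carrier_vec (a * b)"
    by (simp add: z tensor_vec_carrier)
  fix z' assume "z' \<in> A \<times> B"
  then obtain x' y' where z': "z' = (x', y')" "x' \<in> A" "y' \<in> B" by auto
  note carrier_z' = orthonormal_onD(1)[OF u z'(2)] orthonormal_onD(1)[OF v[OF z'(2)] z'(3)]
  have "tensor_vec (u x) (v x y) \<bullet>c tensor_vec (u x') (v x' y') = (u x \<bullet>c u x') * (v x y \<bullet>c v x' y')"
    using carrier_z carrier_z' by (intro tensor_vec_cscalar_prod)
  also have "\<dots> = (if z = z' then 1 else 0)"
    using orthonormal_onD(2)[OF u z(2) z'(2)] orthonormal_onD(2)[OF v[OF z(2)] z(3) z'(3)]
    by (auto simp: z z')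
  finally show "(case z of (x, y) \<Rightarrow> tensor_vec (u x) (v x y))
        \<bullet>c (case z' of (x, y) \<Rightarrow> tensor_vec (u x) (v x y))
      = (if z = z' then 1 else 0)"
    by (simp add: z z')
qed

lemma tensor_mat_mixture:
  assumes u: "\<And>s. s \<in> S \<Longrightarrow> u s \<in> carrier_vec a" and v: "\<And>t. t \<in> T \<Longrightarrow> v t \<in> carrier_vec b"
  shows "tensor_mat (mixture a c u S) (mixture b c' v T)
    = mixture (a * b) (\<lambda>(s, t). c s * c' t) (\<lambda>(s, t). tensor_vec (u s) (v t)) (S \<times> T)"
proof (rule eq_matI)
  let ?M = "mixture (a * b) (\<lambda>(s, t). c s * c' t) (\<lambda>(s, t). tensor_vec (u s) (v t)) (S \<times> T)"
  fix i j assume "i < dim_row ?M" "j < dim_col ?M"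
  then have ij: "i < a * b" "j < a * b" by (simp_all add: mixture_dim)
  then have "0 < b" by (cases b) auto
  then have divmod: "i div b < a" "j div b < a" "i mod b < b" "j mod b < b"
    using ij by (simp_all add: less_mult_imp_div_less)
  have uv: "(case z of (s, t) \<Rightarrow> tensor_vec (u s) (v t)) \<in> carrier_vec (a * b)" if "z \<in> S \<times> T" for z
    using that u v by (auto intro: tensor_vec_carrier)
  have "tensor_mat (mixture a c u S) (mixture b c' v T) $$ (i, j)
      = mixture a c u S $$ (i div b, j div b) * mixture b c' v T $$ (i mod b, j mod b)"
    using ij by (simp add: tensor_mat_def mixture_dim)
  also have "\<dots> = (\<Sum>s\<in>S. \<Sum>t\<in>T. complex_of_real (c s) * (u s $ (i div b) * cnj (u s $ (j div b)))
      * (complex_of_real (c' t) * (v t $ (i mod b) * cnj (v t $ (j mod b)))))"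
    using divmod by (simp add: mixture_index[OF u] mixture_index[OF v] sum_product)
  also have "\<dots> = (\<Sum>s\<in>S. \<Sum>t\<in>T. complex_of_real (c s * c' t)
      * (tensor_vec (u s) (v t) $ i * cnj (tensor_vec (u s) (v t) $ j)))"
    using ij by (intro sum.cong refl) (simp add: tensor_vec_index[OF u v] mult_ac)
  also have "\<dots> = ?M $$ (i, j)"
    using ij by (simp add: mixture_index[OF uv] sum.cartesian_product')
  finally show "tensor_mat (mixture a c u S) (mixture b c' v T) $$ (i, j) = ?M $$ (i, j)" .
qed (simp_all add: tensor_mat_def mixture_dim)

lemma mixture_tensor_vec_block_index:
  assumes "\<And>s. s \<in> S \<Longrightarrow> u s \<in> carrier_vec a" "\<And>s. s \<in> S \<Longrightarrow> v s \<in> carrier_vec b"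
    and "i < a" "j < a" "l < b" "m < b"
  shows "mixture (a * b) c (\<lambda>s. tensor_vec (u s) (v s)) S $$ (i * b + l, j * b + m)
    = (\<Sum>s\<in>S. complex_of_real (c s) * ((u s $ i * cnj (u s $ j)) * (v s $ l * cnj (v s $ m))))"
proof -
  have "tensor_vec (u s) (v s) \<in> carrier_vec (a * b)" if "s \<in> S" for s
    using tensor_vec_carrier assms(1,2) that by blast
  then show ?thesis
    using assms by (simp add: mixture_index block_index_less tensor_vec_block_index[of _ a _ b])
      (simp add: mult_ac)
qed

lemma ptrace_B_mixture:
  assumes u: "\<And>s. s \<in> S \<Longrightarrow> u s \<in> carrier_vec a" and v: "\<And>s. s \<in> S \<Longrightarrow> v s \<in> carrier_vec b"
  shows "ptrace_B a b (mixture (a * b) c (\<lambda>s. tensor_vec (u s) (v s)) S)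
    = mixture a (\<lambda>s. c s * sq_norm (v s)) u S" (is "ptrace_B a b ?M = ?N")
proof (rule eq_matI)
  fix i j assume "i < dim_row ?N" "j < dim_col ?N"
  then have ij: "i < a" "j < a" by (simp_all add: mixture_dim)
  have "ptrace_B a b ?M $$ (i, j) = (\<Sum>m<b. \<Sum>s\<in>S.
      complex_of_real (c s) * ((u s $ i * cnj (u s $ j)) * (v s $ m * cnj (v s $ m))))"
    using ij by (simp add: ptrace_B_def mixture_tensor_vec_block_index[OF u v])
  also have "\<dots> = (\<Sum>s\<in>S. complex_of_real (c s) * ((u s $ i * cnj (u s $ j)) * (v s \<bullet>c v s)))"
    using v by (subst sum.swap) (simp add: cscalar_prod_sum[of _ b] sum_distrib_left atLeast0LessThan)
  also have "\<dots> = ?N $$ (i, j)"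
    using ij by (simp add: mixture_index[OF u] cscalar_prod_self mult_ac)
  finally show "ptrace_B a b ?M $$ (i, j) = ?N $$ (i, j)" .
qed (simp_all add: ptrace_B_def mixture_dim)

lemma ptrace_A_mixture:
  assumes u: "\<And>s. s \<in> S \<Longrightarrow> u s \<in> carrier_vec a" and v: "\<And>s. s \<in> S \<Longrightarrow> v s \<in> carrier_vec b"
  shows "ptrace_A a b (mixture (a * b) c (\<lambda>s. tensor_vec (u s) (v s)) S)
    = mixture b (\<lambda>s. c s * sq_norm (u s)) v S" (is "ptrace_A a b ?M = ?N")
proof (rule eq_matI)
  fix i j assume "i < dim_row ?N" "j < dim_col ?N"
  then have ij: "i < b" "j < b" by (simp_all add: mixture_dim)
  have "ptrace_A a b ?M $$ (i, j) = (\<Sum>l<a. \<Sum>s\<in>S.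
      complex_of_real (c s) * ((u s $ l * cnj (u s $ l)) * (v s $ i * cnj (v s $ j))))"
    using ij by (simp add: ptrace_A_def mixture_tensor_vec_block_index[OF u v])
  also have "\<dots> = (\<Sum>s\<in>S. complex_of_real (c s) * ((u s \<bullet>c u s) * (v s $ i * cnj (v s $ j))))"
    using u by (subst sum.swap)
      (simp add: cscalar_prod_sum[of _ a] sum_distrib_left sum_distrib_right atLeast0LessThan)
  also have "\<dots> = ?N $$ (i, j)"
    using ij by (simp add: mixture_index[OF v] cscalar_prod_self mult_ac)
  finally show "ptrace_A a b ?M $$ (i, j) = ?N $$ (i, j)" .
qed (simp_all add: ptrace_A_def mixture_dim)

lemma tensor_vec_list_Nil: "tensor_vec_list [] = vec 1 (\<lambda>_. 1)"
  by (simp add: tensor_vec_list_def)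

lemma tensor_vec_list_Cons: "tensor_vec_list (v # vs) = tensor_vec v (tensor_vec_list vs)"
  by (simp add: tensor_vec_list_def)

lemma tensor_vec_list_carrier:
  "(\<And>v. v \<in> set vs \<Longrightarrow> v \<in> carrier_vec d) \<Longrightarrow> tensor_vec_list vs \<in> carrier_vec (d ^ length vs)"
  by (induction vs) (auto simp: tensor_vec_list_Nil tensor_vec_list_Cons intro!: tensor_vec_carrier)

lemma orthonormal_on_tensor_vec_list:
  assumes "\<And>x. x \<in> set xs \<Longrightarrow> orthonormal_on d (e x) S"
  shows "orthonormal_on (d ^ length xs) (\<lambda>ss. tensor_vec_list (map2 e xs ss)) (seqs (length xs) S)"
  using assms
proof (induction xs)
  case Nil
  then show ?case by (simp add: orthonormal_on_def seqs_0 tensor_vec_list_Nil scalar_prod_def)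
next
  case (Cons x xs)
  have "orthonormal_on (d * d ^ length xs)
        (\<lambda>(s, ss). tensor_vec (e x s) (tensor_vec_list (map2 e xs ss)))
      (S \<times> seqs (length xs) S)"
    using Cons by (intro orthonormal_on_tensor_vec) auto
  then have "orthonormal_on (d ^ length (x # xs))
      (\<lambda>z. tensor_vec_list (map2 e (x # xs) (case z of (s, ss) \<Rightarrow> s # ss))) (S \<times> seqs (length xs) S)"
    by (simp add: case_prod_unfold tensor_vec_list_Cons)
  then show ?case
    using orthonormal_on_reindex[OF bij_betw_Cons_seqs] by simp
qed

lemma tensor_mat_list_mixture:
  assumes "\<And>x s. x \<in> set xs \<Longrightarrow> s \<in> S \<Longrightarrow> e x s \<in> carrier_vec d"
  shows "tensor_mat_list (map (\<lambda>x. mixture d (q x) (e x) S) xs) = mixture (d ^ length xs)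
    (\<lambda>ss. prod_list (map2 q xs ss)) (\<lambda>ss. tensor_vec_list (map2 e xs ss)) (seqs (length xs) S)"
  using assms
proof (induction xs)
  case Nil
  show ?case
    by (rule eq_matI)
      (auto simp: tensor_mat_list_def mixture_dim mixture_index seqs_0 tensor_vec_list_Nil)
next
  case (Cons x xs)
  let ?w = "\<lambda>xs ss. prod_list (map2 q xs ss)" and ?v = "\<lambda>xs ss. tensor_vec_list (map2 e xs ss)"
  have tail: "?v xs ss \<in> carrier_vec (d ^ length xs)" if "ss \<in> seqs (length xs) S" for ss
  proof -
    have "u \<in> carrier_vec d" if "u \<in> set (map2 e xs ss)" for u
      using that Cons.prems \<open>ss \<in> seqs (length xs) S\<close>
      by (fastforce simp: seqs_def dest: set_zip_leftD set_zip_rightD)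
    then have "?v xs ss \<in> carrier_vec (d ^ length (map2 e xs ss))" by (rule tensor_vec_list_carrier)
    then show ?thesis using that by (simp add: seqs_def)
  qed
  have "tensor_mat_list (map (\<lambda>x. mixture d (q x) (e x) S) (x # xs))
      = tensor_mat (mixture d (q x) (e x) S)
          (mixture (d ^ length xs) (?w xs) (?v xs) (seqs (length xs) S))"
    using Cons by (simp add: tensor_mat_list_def)
  also have "\<dots> = mixture (d * d ^ length xs) (\<lambda>(s, ss). q x s * ?w xs ss)
        (\<lambda>(s, ss). tensor_vec (e x s) (?v xs ss))
      (S \<times> seqs (length xs) S)"
    using Cons.prems tail by (intro tensor_mat_mixture) auto
  also have "\<dots> = mixture (d ^ length (x # xs)) (\<lambda>z. ?w (x # xs) (case z of (s, ss) \<Rightarrow> s # ss))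
      (\<lambda>z. ?v (x # xs) (case z of (s, ss) \<Rightarrow> s # ss)) (S \<times> seqs (length xs) S)"
    by (simp add: case_prod_unfold tensor_vec_list_Cons)
  also have "\<dots> = mixture (d ^ length (x # xs)) (?w (x # xs)) (?v (x # xs)) (seqs (length (x # xs)) S)"
    using mixture_reindex_bij_betw[OF bij_betw_Cons_seqs] by simp
  finally show ?case .
qed

lemma tensor_power_mixture:
  assumes "\<And>s. s \<in> S \<Longrightarrow> u s \<in> carrier_vec d"
  shows "tensor_mat_list (replicate n (mixture d c u S))
    = mixture (d ^ n) (\<lambda>ss. prod_list (map c ss)) (\<lambda>ss. tensor_vec_list (map u ss)) (seqs n S)"
proof -
  have "tensor_mat_list (replicate n (mixture d c u S)) = mixture (d ^ n)
      (\<lambda>ss. prod_list (map2 (\<lambda>_. c) (replicate n ()) ss))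
      (\<lambda>ss. tensor_vec_list (map2 (\<lambda>_. u) (replicate n ()) ss)) (seqs n S)"
    using tensor_mat_list_mixture[of "replicate n ()" S "\<lambda>_. u" d "\<lambda>_. c"] assms by simp
  also have "\<dots> = mixture (d ^ n) (\<lambda>ss. prod_list (map c ss))
        (\<lambda>ss. tensor_vec_list (map u ss)) (seqs n S)"
    by (intro mixture_cong) (simp_all add: zip_replicate1 seqs_def comp_def)
  finally show ?thesis .
qed

lemma orthonormal_on_tensor_power:
  assumes "orthonormal_on d f S"
  shows "orthonormal_on (d ^ n) (\<lambda>ss. tensor_vec_list (map f ss)) (seqs n S)"
  using orthonormal_on_tensor_vec_list[of "replicate n ()" d "\<lambda>_. f" S] assms
  by (simp add: orthonormal_on_def zip_replicate1 seqs_def comp_def)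

text \<open>Both sides are traces against the same tensor power.\<close>
lemma iid_expect_sq_norm_eq:
  assumes "mixture d c u S = mixture d r f T" and L: "L \<in> carrier_mat m (d ^ n)"
    and u: "\<And>s. s \<in> S \<Longrightarrow> u s \<in> carrier_vec d" and f: "\<And>t. t \<in> T \<Longrightarrow> f t \<in> carrier_vec d"
  shows "iid_expect n S c (\<lambda>ss. sq_norm (L *\<^sub>v tensor_vec_list (map u ss)))
    = iid_expect n T r (\<lambda>ts. sq_norm (L *\<^sub>v tensor_vec_list (map f ts)))"
proof -
  have power: "tensor_vec_list (map g ss) \<in> carrier_vec (d ^ n)"
    if "ss \<in> seqs n A" "\<And>s. s \<in> A \<Longrightarrow> g s \<in> carrier_vec d" for A and g :: "'c \<Rightarrow> complex vec" and ss
    using that tensor_vec_list_carrier[of "map g ss" d] by (auto simp: seqs_def)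
  show ?thesis
    unfolding iid_expect_eq_sum
    by (rule mixture_eq_imp_sq_norm_sum_eq[OF _ _ _ L])
      (simp_all add: power u f assms(1) flip: tensor_power_mixture[OF u] tensor_power_mixture[OF f])
qed

lemma fail_op_carrier:
  assumes "\<forall>P\<in>set Ps. projection D P"
  shows "fail_op D Ps m \<in> carrier_mat D D"
proof -
  have "foldl (\<lambda>K P. (1\<^sub>m D - P) * K) K Qs \<in> carrier_mat D D"
    if "\<forall>P\<in>set Qs. projection D P" "K \<in> carrier_mat D D" for K Qs
    using that by (induction Qs arbitrary: K)
      (auto intro!: mult_carrier_mat minus_carrier_mat dest: projection_carrier)
  from this[of "take m Ps" "1\<^sub>m D"] show ?thesis using assms
    by (auto simp: fail_op_def dest: in_set_takeD)
qed

lemma fail_op_mult_vec: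
  assumes "\<forall>P\<in>set Ps. projection D P" "v \<in> carrier_vec D"
  shows "fail_op D Ps m *\<^sub>v v = fold (*\<^sub>v) (map (\<lambda>P. 1\<^sub>m D - P) (take m Ps)) v"
proof -
  have "foldl (\<lambda>K P. (1\<^sub>m D - P) * K) K Qs *\<^sub>v v = fold (*\<^sub>v) (map (\<lambda>P. 1\<^sub>m D - P) Qs) (K *\<^sub>v v)"
    if "\<forall>P\<in>set Qs. projection D P" "K \<in> carrier_mat D D" for K Qs
    using that
  proof (induction Qs arbitrary: K)
    case (Cons P Qs)
    then have "1\<^sub>m D - P \<in> carrier_mat D D" by (auto intro: minus_carrier_mat projection_carrier)
    then show ?case using Cons.IH[of "(1\<^sub>m D - P) * K"] Cons.prems assms(2) by simp
  qed simp
  from this[of "take m Ps" "1\<^sub>m D"] show ?thesis using assms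
    by (auto simp: fail_op_def dest: in_set_takeD)
qed

lemma seq_output_prob_mixture:
  assumes Ps: "\<forall>P\<in>set Ps. projection D P" "m < length Ps" and u: "\<And>s. s \<in> S \<Longrightarrow> u s \<in> carrier_vec D"
  shows "seq_output_prob D Ps (mixture D c u S) m
    = (\<Sum>s\<in>S. c s * sq_norm (fold (*\<^sub>v) (map (\<lambda>P. 1\<^sub>m D - P) (take m Ps) @ [Ps ! m]) (u s)))"
proof -
  let ?K = "fail_op D Ps m" and ?P = "Ps ! m" and ?M = "mixture D c u S"
  have P: "?P \<in> carrier_mat D D" using Ps by (auto intro: projection_carrier)
  note K = fail_op_carrier[OF Ps(1), of m]
  have M: "?M \<in> carrier_mat D D" by (rule mixture_carrier)
  have "?P * ?K * ?M * mat_adjoint ?K * mat_adjoint ?P = (?P * ?K) * ?M * mat_adjoint (?P * ?K)"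
    using P K M mat_adjoint_carrier[OF P] mat_adjoint_carrier[OF K]
    by (simp add: mat_adjoint_mult[OF P K] assoc_mult_mat[of _ D D _ D _ D])
  then have "seq_output_prob D Ps ?M m = (\<Sum>s\<in>S. c s * sq_norm ((?P * ?K) *\<^sub>v u s))"
    using mtrace_mixture_conj[of "?P * ?K" D D S u c] P K u by (simp add: seq_output_prob_def)
  also have "(?P * ?K) *\<^sub>v u s = fold (*\<^sub>v) (map (\<lambda>P. 1\<^sub>m D - P) (take m Ps) @ [?P]) (u s)" if "s \<in> S"
    for s
    using P K u[OF that] fail_op_mult_vec[OF Ps(1) u[OF that], of m] by simp
  then have "(\<Sum>s\<in>S. c s * sq_norm ((?P * ?K) *\<^sub>v u s))
      = (\<Sum>s\<in>S. c s * sq_norm (fold (*\<^sub>v) (map (\<lambda>P. 1\<^sub>m D - P) (take m Ps) @ [?P]) (u s)))"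
    by simp
  finally show ?thesis .
qed

section \<open>Classical-quantum channels\<close>

lemma ket_carrier: "ket D i \<in> carrier_vec D"
  by (simp add: ket_def)

lemma orthonormal_on_ket: "orthonormal_on D (ket D) {0..<D}"
proof -
  have "ket D i = unit_vec D i" "conjugate (unit_vec D i :: complex vec) = unit_vec D i" if "i < D" for i
    using that by (auto simp: ket_def unit_vec_def)
  then show ?thesis by (auto simp: orthonormal_on_def)
qed

locale cq_channel =
  fixes k d :: nat and p :: "nat \<Rightarrow> real" and \<rho> :: "nat \<Rightarrow> complex mat"
    and e :: "nat \<Rightarrow> nat \<Rightarrow> complex vec" and q :: "nat \<Rightarrow> nat \<Rightarrow> real"
  assumes p_distribution: "distribution {0..<k} p"
    and q_distribution: "x < k \<Longrightarrow> distribution {0..<d} (q x)"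
    and e_orthonormal: "x < k \<Longrightarrow> orthonormal_on d (e x) {0..<d}"
    and rho_eq: "x < k \<Longrightarrow> \<rho> x = mixture d (q x) (e x) {0..<d}"
begin

abbreviation pairs :: "(nat \<times> nat) set" where
  "pairs \<equiv> {0..<k} \<times> {0..<d}"

abbreviation eigvec :: "nat \<times> nat \<Rightarrow> complex vec" where
  "eigvec \<equiv> case_prod e"

abbreviation output_cond_entropy :: real where
  "output_cond_entropy \<equiv> cond_entropy {0..<k} p {0..<d} q"

definition avg_state :: "complex mat" where
  "avg_state = mixture d (joint p q) eigvec pairs"

lemma joint_distribution: "distribution pairs (joint p q)"
  by (rule distribution_joint[OF p_distribution]) (simp add: q_distribution)

lemma eigvec_carrier: "z \<in> pairs \<Longrightarrow> eigvec z \<in> carrier_vec d"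
  using orthonormal_onD(1)[OF e_orthonormal] by (cases z) auto

lemma sq_norm_eigvec: "z \<in> pairs \<Longrightarrow> sq_norm (eigvec z) = 1"
  using sq_norm_orthonormal_on[OF e_orthonormal] by (cases z) auto

lemma cq_state_eq_mixture:
  "cq_state k d p \<rho> = mixture (k * d) (joint p q) (\<lambda>z. tensor_vec (ket k (fst z)) (eigvec z)) pairs"
    (is "_ = ?M")
proof (rule eq_matI)
  fix i j assume "i < dim_row ?M" "j < dim_col ?M"
  then have ij: "i < k * d" "j < k * d" by (simp_all add: mixture_dim)
  then have "0 < d" by (cases d) auto
  then have divmod: "i div d < k" "j div d < k" "i mod d < d" "j mod d < d"
    using ij by (simp_all add: less_mult_imp_div_less)
  have u: "tensor_vec (ket k (fst z)) (eigvec z) \<in> carrier_vec (k * d)" if "z \<in> pairs" for z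
    by (rule tensor_vec_carrier[OF ket_carrier eigvec_carrier[OF that]])
  have "(complex_of_real (p x) \<cdot>\<^sub>m tensor_mat (outer (ket k x)) (\<rho> x)) $$ (i, j)
      = (\<Sum>s\<in>{0..<d}. complex_of_real (joint p q (x, s))
        * (tensor_vec (ket k x) (e x s) $ i * cnj (tensor_vec (ket k x) (e x s) $ j)))"
    if x: "x < k" for x
  proof -
    have ex: "e x s \<in> carrier_vec d" if "s \<in> {0..<d}" for s
      by (rule orthonormal_onD(1)[OF e_orthonormal[OF x] that])
    have "(complex_of_real (p x) \<cdot>\<^sub>m tensor_mat (outer (ket k x)) (\<rho> x)) $$ (i, j)
        = complex_of_real (p x) * (ket k x $ (i div d) * cnj (ket k x $ (j div d))
          * (\<Sum>s\<in>{0..<d}. complex_of_real (q x s) * (e x s $ (i mod d) * cnj (e x s $ (j mod d)))))"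
      using mixture_index[of "{0..<d}" "e x" d "i mod d" "j mod d" "q x"] ex
        ij divmod carrier_vecD[OF ket_carrier[of k x]]
      by (simp add: rho_eq[OF x] tensor_mat_def outer_def mixture_dim)
    then show ?thesis
      using ij by (simp add: tensor_vec_index[OF ket_carrier ex] joint_def sum_distrib_left mult_ac)
  qed
  then have "cq_state k d p \<rho> $$ (i, j) = (\<Sum>x\<in>{0..<k}. \<Sum>s\<in>{0..<d}. complex_of_real (joint p q (x, s))
        * (tensor_vec (ket k x) (e x s) $ i * cnj (tensor_vec (ket k x) (e x s) $ j)))"
    using ij by (simp add: cq_state_def sum_matrix_def)
  then show "cq_state k d p \<rho> $$ (i, j) = ?M $$ (i, j)"
    using ij by (simp add: mixture_index[OF u] sum.cartesian_product')
qed (simp_all add: cq_state_def sum_matrix_def mixture_dim)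

lemma ptrace_A_cq_state: "ptrace_A k d (cq_state k d p \<rho>) = avg_state"
proof -
  have "ptrace_A k d (cq_state k d p \<rho>)
      = mixture d (\<lambda>z. joint p q z * sq_norm (ket k (fst z))) eigvec pairs"
    unfolding cq_state_eq_mixture by (rule ptrace_A_mixture) (simp_all add: ket_carrier eigvec_carrier)
  also have "\<dots> = avg_state"
    unfolding avg_state_def
    by (rule mixture_cong) (auto simp: sq_norm_orthonormal_on[OF orthonormal_on_ket])
  finally show ?thesis .
qed

lemma ptrace_B_cq_state: "ptrace_B k d (cq_state k d p \<rho>) = mixture k p (ket k) {0..<k}"
proof -
  have "ptrace_B k d (cq_state k d p \<rho>)
      = mixture k (\<lambda>z. joint p q z * sq_norm (eigvec z)) (\<lambda>z. ket k (fst z)) pairs"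
    unfolding cq_state_eq_mixture by (rule ptrace_B_mixture) (simp_all add: ket_carrier eigvec_carrier)
  also have "\<dots> = mixture k (joint p q) (\<lambda>z. ket k (fst z)) pairs"
    by (rule mixture_cong) (simp_all add: sq_norm_eigvec)
  also have "\<dots> = mixture k p (ket k) {0..<k}"
    by (rule mixture_joint_fst) (simp_all add: q_distribution ket_carrier)
  finally show ?thesis .
qed

lemma mutual_info_cq_state:
  "mutual_info k d (cq_state k d p \<rho>) = vn_entropy avg_state - output_cond_entropy"
proof -
  have "vn_entropy (mixture k p (ket k) {0..<k}) = shannon_entropy {0..<k} p"
    by (rule vn_entropy_mixture) (simp_all add: orthonormal_on_ket)
  moreover have "vn_entropy (cq_state k d p \<rho>) = shannon_entropy pairs (joint p q)"
    unfolding cq_state_eq_mixture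
    using orthonormal_on_tensor_vec[OF orthonormal_on_ket, of k d e "{0..<d}"] e_orthonormal
    by (intro vn_entropy_mixture) (simp_all add: case_prod_unfold)
  moreover have "\<dots> = shannon_entropy {0..<k} p + output_cond_entropy"
    by (rule shannon_entropy_joint[OF p_distribution]) (simp add: q_distribution)
  ultimately show ?thesis by (simp add: mutual_info_def ptrace_A_cq_state ptrace_B_cq_state)
qed

lemma avg_state_spectral_decomposition:
  obtains f r where "orthonormal_on d f {0..<d}" "avg_state = mixture d r f {0..<d}"
  by (rule hermitian_spectral_decomposition[of avg_state d])
    (simp_all add: avg_state_def mixture_carrier mat_adjoint_mixture[of pairs, OF eigvec_carrier])

section \<open>Random codes with sequential decoding\<close>

abbreviation dec :: "real \<Rightarrow> nat list \<Rightarrow> complex mat" where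
  "dec \<equiv> dec_proj k d p e q"

definition state_vec :: "(nat \<times> nat) list \<Rightarrow> complex vec" where
  "state_vec zs = tensor_vec_list (map eigvec zs)"

abbreviation cond_expect :: "nat list \<Rightarrow> ((nat \<times> nat) list \<Rightarrow> real) \<Rightarrow> real" where
  "cond_expect xs F \<equiv> indep_expect {0..<d} (map q xs) (\<lambda>ss. F (zip xs ss))"

abbreviation joint_expect :: "nat \<Rightarrow> ((nat \<times> nat) list \<Rightarrow> real) \<Rightarrow> real" where
  "joint_expect n \<equiv> iid_expect n pairs (joint p q)"

abbreviation code_expect :: "nat \<Rightarrow> nat \<Rightarrow> (nat list list \<Rightarrow> real) \<Rightarrow> real" where
  "code_expect n M \<equiv> iid_expect M (seqs n {0..<k}) (\<lambda>xs. prod_list (map p xs))"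

definition message_error :: "nat \<Rightarrow> real \<Rightarrow> nat \<Rightarrow> nat list list \<Rightarrow> real" where
  "message_error n \<delta> m cb
    = 1 - seq_output_prob (d ^ n) (map (dec \<delta>) cb) (tensor_mat_list (map \<rho> (cb ! m))) m"

lemma cond_distribution:
  "xs \<in> seqs n {0..<k} \<Longrightarrow> Q \<in> set (map q xs) \<Longrightarrow> distribution {0..<d} Q"
  using seqs_letter_less[of xs n k] q_distribution by auto

lemma orthonormal_on_state_vec:
  assumes "xs \<in> seqs n {0..<k}"
  shows "orthonormal_on (d ^ n) (\<lambda>ss. state_vec (zip xs ss)) (seqs n {0..<d})"
proof -
  have "length xs = n" using assms by (simp add: seqs_def)
  then show ?thesis
    using orthonormal_on_tensor_vec_list[of xs d e "{0..<d}"] e_orthonormal seqs_letter_less[OF assms]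
    by (simp add: state_vec_def)
qed

lemma state_vec_unit:
  assumes "zs \<in> seqs n pairs"
  shows "state_vec zs \<in> carrier_vec (d ^ n)" "sq_norm (state_vec zs) = 1"
proof -
  note zs = map_fst_snd_mem_seqs[OF assms]
  have "state_vec zs = state_vec (zip (map fst zs) (map snd zs))" by (simp add: zip_map_fst_snd)
  then show "state_vec zs \<in> carrier_vec (d ^ n)" "sq_norm (state_vec zs) = 1"
    using orthonormal_onD(1)[OF orthonormal_on_state_vec[OF zs(1)] zs(2)]
      sq_norm_orthonormal_on[OF orthonormal_on_state_vec[OF zs(1)] zs(2)] by simp_all
qed

lemma tensor_state_eq_mixture:
  assumes "xs \<in> seqs n {0..<k}"
  shows "tensor_mat_list (map \<rho> xs) = mixture (d ^ n)
    (\<lambda>ss. prod_list (map2 q xs ss)) (\<lambda>ss. state_vec (zip xs ss)) (seqs n {0..<d})"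
proof -
  have "length xs = n" using assms by (simp add: seqs_def)
  moreover have rho: "map \<rho> xs = map (\<lambda>x. mixture d (q x) (e x) {0..<d}) xs"
    using seqs_letter_less[OF assms] by (simp add: rho_eq)
  moreover have "e x s \<in> carrier_vec d" if "x \<in> set xs" "s \<in> {0..<d}" for x s
    using orthonormal_onD(1)[OF e_orthonormal] seqs_letter_less[OF assms] that by blast
  ultimately show ?thesis
    unfolding rho using tensor_mat_list_mixture[of xs "{0..<d}" e d q] by (simp add: state_vec_def)
qed

lemma cond_typ_proj_eq_span_proj:
  assumes "xs \<in> seqs n {0..<k}"
  shows "cond_typ_proj k d e q \<delta> xs
      = span_proj (d ^ n) (\<lambda>ss. state_vec (zip xs ss)) (cond_typical_seqs k d q \<delta> xs)"
proof -
  have "1 \<cdot>\<^sub>m A = A" for A :: "complex mat" by (rule eq_matI) auto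
  then show ?thesis
    using assms
    by (simp add: cond_typ_proj_def span_proj_def mixture_def state_vec_def cond_typical_seqs_def seqs_def)
qed

lemma orthonormal_on_cond_typical:
  assumes "xs \<in> seqs n {0..<k}"
  shows "orthonormal_on (d ^ n) (\<lambda>ss. state_vec (zip xs ss)) (cond_typical_seqs k d q \<delta> xs)"
  using assms
  by (intro orthonormal_on_subset[OF orthonormal_on_state_vec[OF assms]])
    (auto simp: cond_typical_seqs_def seqs_def)

lemma dec_eq:
  assumes "xs \<in> seqs n {0..<k}" "0 < n"
  shows "dec \<delta> xs = (if typical {0..<k} p \<delta> xs
    then span_proj (d ^ n) (\<lambda>ss. state_vec (zip xs ss)) (cond_typical_seqs k d q \<delta> xs)
    else 0\<^sub>m (d ^ n) (d ^ n))"
proof -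
  have "length xs = n" using assms(1) by (simp add: seqs_def)
  then show ?thesis
    using assms by (simp add: dec_proj_def mem_typical_set_iff cond_typ_proj_eq_span_proj)
qed

lemma projection_dec:
  assumes "xs \<in> seqs n {0..<k}" "0 < n"
  shows "projection (d ^ n) (dec \<delta> xs)"
  by (simp add: dec_eq[OF assms] projection_zero
      projection_span_proj[OF finite_cond_typical_seqs orthonormal_on_cond_typical[OF assms(1)]])

lemma sum_sq_norm_dec_le:
  assumes ys: "ys \<in> seqs n {0..<k}" and "0 < n" "0 \<le> \<delta>" and b: "finite T" "orthonormal_on (d ^ n) b T"
  shows "(\<Sum>t\<in>T. sq_norm (dec \<delta> ys *\<^sub>v b t)) \<le> 2 powr (real n * (1 + \<delta>)\<^sup>2 * output_cond_entropy)"
proof (cases "typical {0..<k} p \<delta> ys")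
  case True
  have "(\<Sum>t\<in>T. sq_norm (dec \<delta> ys *\<^sub>v b t)) \<le> real (card (cond_typical_seqs k d q \<delta> ys))"
    using True sum_sq_norm_span_proj_le_card[OF finite_cond_typical_seqs orthonormal_on_cond_typical[OF ys] b]
    by (simp add: dec_eq[OF ys \<open>0 < n\<close>])
  also have "\<dots> \<le> 2 powr (real n * (1 + \<delta>)\<^sup>2 * output_cond_entropy)"
    by (rule card_cond_typical_seqs_le[OF p_distribution q_distribution ys True \<open>0 \<le> \<delta>\<close>])
  finally show ?thesis .
next
  case False
  have "0\<^sub>m (d ^ n) (d ^ n) *\<^sub>v b t = 0\<^sub>v (d ^ n)" if "t \<in> T" for t
    using orthonormal_onD(1)[OF b(2) that] by (intro eq_vecI) auto
  then show ?thesis using False by (simp add: dec_eq[OF ys \<open>0 < n\<close>] sq_norm_zero)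
qed

definition loss :: "complex mat \<Rightarrow> nat list \<Rightarrow> real" where
  "loss P xs = cond_expect xs (\<lambda>zs. sq_norm (state_vec zs - P *\<^sub>v state_vec zs))"

definition confusion :: "complex mat \<Rightarrow> complex mat \<Rightarrow> nat list \<Rightarrow> real" where
  "confusion P0 P xs = cond_expect xs (\<lambda>zs. sq_norm (P *\<^sub>v (P0 *\<^sub>v state_vec zs)))"

lemma message_error_eq_cond_expect:
  assumes cb: "cb \<in> seqs M (seqs n {0..<k})" and m: "m < M" and n: "0 < n"
  shows "message_error n \<delta> m cb = cond_expect (cb ! m) (\<lambda>zs. 1 - sq_norm (fold (*\<^sub>v)
    (map (\<lambda>P. 1\<^sub>m (d ^ n) - P) (take m (map (dec \<delta>) cb)) @ [dec \<delta> (cb ! m)]) (state_vec zs)))"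
proof -
  define xs where "xs = cb ! m"
  let ?Ps = "map (dec \<delta>) cb"
  have len: "length cb = M" and words: "set cb \<subseteq> seqs n {0..<k}"
    using cb by (simp_all add: seqs_def[of M])
  then have xs: "xs \<in> seqs n {0..<k}" using m by (auto simp: xs_def)
  have Ps: "\<forall>P\<in>set ?Ps. projection (d ^ n) P" using words n by (auto intro: projection_dec)
  note q = cond_distribution[OF xs]
  have "seq_output_prob (d ^ n) ?Ps (tensor_mat_list (map \<rho> xs)) m = cond_expect xs
      (\<lambda>zs. sq_norm (fold (*\<^sub>v) (map (\<lambda>P. 1\<^sub>m (d ^ n) - P) (take m ?Ps) @ [?Ps ! m]) (state_vec zs)))"
  proof -
    have "length xs = n" using xs by (simp add: seqs_def)
    then show ?thesis
      unfolding tensor_state_eq_mixture[OF xs] indep_expect_map_eq_sum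
      using seq_output_prob_mixture[OF Ps, of m "seqs n {0..<d}" "\<lambda>ss. state_vec (zip xs ss)"]
        m len orthonormal_onD(1)[OF orthonormal_on_state_vec[OF xs]] by simp
  qed
  then show ?thesis
    using indep_expect_const[of "map q xs" "{0..<d}" 1] q m len
    by (simp add: message_error_def indep_expect_diff flip: xs_def)
qed

lemma message_error_le:
  assumes cb: "cb \<in> seqs M (seqs n {0..<k})" and m: "m < M" and n: "0 < n"
    and P0: "projection (d ^ n) P0" and c: "0 < c"
  shows "message_error n \<delta> m cb
    \<le> c + (10 + 1 / c) * loss P0 (cb ! m) + 4 * (\<Sum>i<m. confusion P0 (dec \<delta> (cb ! i)) (cb ! m))
      + 8 * loss (dec \<delta> (cb ! m)) (cb ! m)"
proof -
  define xs where "xs = cb ! m"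
  let ?Ps = "take m (map (dec \<delta>) cb)"
  have len: "length cb = M" and words: "set cb \<subseteq> seqs n {0..<k}"
    using cb by (simp_all add: seqs_def[of M])
  then have xs: "xs \<in> seqs n {0..<k}" using m by (auto simp: xs_def)
  have "\<forall>P\<in>set (map (dec \<delta>) cb). projection (d ^ n) P" using words n by (auto intro: projection_dec)
  then have Ps: "\<forall>P\<in>set ?Ps. projection (d ^ n) P" by (meson in_set_takeD)
  note q = cond_distribution[OF xs]
  have "message_error n \<delta> m cb = cond_expect xs
      (\<lambda>zs. 1 - sq_norm (fold (*\<^sub>v) (map (\<lambda>P. 1\<^sub>m (d ^ n) - P) ?Ps @ [dec \<delta> xs]) (state_vec zs)))"
    unfolding xs_def by (rule message_error_eq_cond_expect[OF cb m n])
  also have "\<dots> \<le> cond_expect xs (\<lambda>zs. c + (10 + 1 / c) * sq_norm (state_vec zs - P0 *\<^sub>v state_vec zs)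
      + 4 * (\<Sum>i<m. sq_norm (dec \<delta> (cb ! i) *\<^sub>v (P0 *\<^sub>v state_vec zs)))
      + 8 * sq_norm (state_vec zs - dec \<delta> xs *\<^sub>v state_vec zs))"
  proof (rule indep_expect_mono[OF q])
    fix ss assume "ss \<in> seqs (length (map q xs)) {0..<d}"
    then have "ss \<in> seqs n {0..<d}" using xs by (simp add: seqs_def)
    then have zs: "zip xs ss \<in> seqs n pairs" by (rule zip_mem_seqs[OF xs])
    have "(\<Sum>P\<leftarrow>?Ps. sq_norm (P *\<^sub>v w)) = (\<Sum>i<m. sq_norm (dec \<delta> (cb ! i) *\<^sub>v w))" for w
      using m len by (simp add: sum_list_sum_nth atLeast0LessThan)
    then show "1 - sq_norm (fold (*\<^sub>v) (map (\<lambda>P. 1\<^sub>m (d ^ n) - P) ?Ps @ [dec \<delta> xs])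
        (state_vec (zip xs ss)))
      \<le> c + (10 + 1 / c) * sq_norm (state_vec (zip xs ss) - P0 *\<^sub>v state_vec (zip xs ss))
      + 4 * (\<Sum>i<m. sq_norm (dec \<delta> (cb ! i) *\<^sub>v (P0 *\<^sub>v state_vec (zip xs ss))))
      + 8 * sq_norm (state_vec (zip xs ss) - dec \<delta> xs *\<^sub>v state_vec (zip xs ss))"
      using sequential_decoding_error[OF Ps projection_dec[OF xs n] P0 state_vec_unit[OF zs] c, of \<delta>]
      by (simp only:)
  qed
  also have "\<dots> = c + (10 + 1 / c) * loss P0 xs + 4 * (\<Sum>i<m. confusion P0 (dec \<delta> (cb ! i)) xs)
      + 8 * loss (dec \<delta> xs) xs"
    by (simp only: indep_expect_add indep_expect_cmult indep_expect_sum indep_expect_const[OF q]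
        loss_def confusion_def)
  finally show ?thesis by (simp add: xs_def)
qed

lemma sum_word_prob_cond_expect:
  "(\<Sum>xs\<in>seqs n {0..<k}. prod_list (map p xs) * cond_expect xs F) = joint_expect n F"
  unfolding iid_expect_joint by (simp add: iid_expect_eq_sum)

lemma sum_word_prob_loss:
  "(\<Sum>xs\<in>seqs n {0..<k}. prod_list (map p xs) * loss (P xs) xs)
    = joint_expect n (\<lambda>zs. sq_norm (state_vec zs - P (map fst zs) *\<^sub>v state_vec zs))"
proof -
  have "loss (P xs) xs = cond_expect xs (\<lambda>zs. sq_norm (state_vec zs - P (map fst zs) *\<^sub>v state_vec zs))"
    for xs
    unfolding loss_def by (rule indep_expect_cong) (simp add: seqs_def)
  then show ?thesis by (simp only:) (rule sum_word_prob_cond_expect)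
qed

lemma sum_word_prob_confusion:
  "(\<Sum>xs\<in>seqs n {0..<k}. prod_list (map p xs) * confusion P0 P xs)
    = joint_expect n (\<lambda>zs. sq_norm (P *\<^sub>v (P0 *\<^sub>v state_vec zs)))"
  unfolding confusion_def by (rule sum_word_prob_cond_expect)

lemma code_expect_message_error_le:
  assumes m: "m < M" and n: "0 < n" and P0: "projection (d ^ n) P0" and c: "0 < c"
    and confusion: "\<And>ys. ys \<in> seqs n {0..<k} \<Longrightarrow>
      joint_expect n (\<lambda>zs. sq_norm (dec \<delta> ys *\<^sub>v (P0 *\<^sub>v state_vec zs))) \<le> G"
  shows "code_expect n M (message_error n \<delta> m)
    \<le> c + (10 + 1 / c) * joint_expect n (\<lambda>zs. sq_norm (state_vec zs - P0 *\<^sub>v state_vec zs))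
      + 4 * (real m * G)
      + 8 * joint_expect n (\<lambda>zs. sq_norm (state_vec zs - dec \<delta> (map fst zs) *\<^sub>v state_vec zs))"
    (is "_ \<le> c + ?\<kappa> * ?\<alpha> + _ + 8 * ?\<beta>")
proof -
  let ?A = "seqs n {0..<k}" and ?W = "\<lambda>xs. prod_list (map p xs)"
  let ?\<gamma> = "\<lambda>i cb. confusion P0 (dec \<delta> (cb ! i)) (cb ! m)"
  note W = distribution_seqs[OF p_distribution, of n]
  have loss_P0: "code_expect n M (\<lambda>cb. loss P0 (cb ! m)) = ?\<alpha>"
    unfolding iid_expect_nth[OF W m, of "loss P0"] by (rule sum_word_prob_loss)
  have loss_dec: "code_expect n M (\<lambda>cb. loss (dec \<delta> (cb ! m)) (cb ! m)) = ?\<beta>"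
    unfolding iid_expect_nth[OF W m, of "\<lambda>xs. loss (dec \<delta> xs) xs"] by (rule sum_word_prob_loss)
  have confusion_le: "code_expect n M (?\<gamma> i) \<le> G" if i: "i < m" for i
  proof -
    have "code_expect n M (?\<gamma> i) = (\<Sum>ys\<in>?A. ?W ys * (\<Sum>xs\<in>?A. ?W xs * confusion P0 (dec \<delta> ys) xs))"
      by (rule iid_expect_nth2[OF W i m, of "\<lambda>ys xs. confusion P0 (dec \<delta> ys) xs"])
    also have "\<dots> \<le> (\<Sum>ys\<in>?A. ?W ys * G)"
      unfolding sum_word_prob_confusion
      by (intro sum_mono mult_left_mono confusion distributionD(2)[OF W])
    finally show ?thesis by (simp add: distributionD(3)[OF W] flip: sum_distrib_right)
  qed
  have "code_expect n M (message_error n \<delta> m)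
    \<le> code_expect n M (\<lambda>cb. c + ?\<kappa> * loss P0 (cb ! m) + 4 * (\<Sum>i<m. ?\<gamma> i cb)
      + 8 * loss (dec \<delta> (cb ! m)) (cb ! m))"
    using W by (intro indep_expect_mono message_error_le[OF _ m n P0 c]) simp_all
  also have "\<dots> = c + ?\<kappa> * ?\<alpha> + 4 * (\<Sum>i<m. code_expect n M (?\<gamma> i)) + 8 * ?\<beta>"
    by (simp only: indep_expect_add indep_expect_cmult indep_expect_sum iid_expect_const[OF W]
        loss_P0 loss_dec)
  also have "\<dots> \<le> c + ?\<kappa> * ?\<alpha> + 4 * (real m * G) + 8 * ?\<beta>"
    using sum_bounded_above[of "{..<m}" "\<lambda>i. code_expect n M (?\<gamma> i)" G] confusion_le by simp
  finally show ?thesis .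
qed

lemma expected_error_le_if_message_error_le:
  assumes "0 \<le> X"
    and "\<And>m. m < M \<Longrightarrow> code_expect n M (message_error n \<delta> m) \<le> X"
  shows "expected_error k d p \<rho> e q \<delta> n M \<le> X"
proof -
  have "expected_error k d p \<rho> e q \<delta> n M = code_expect n M (avg_error k d p \<rho> e q \<delta> n)"
    by (simp add: expected_error_def iid_expect_eq_sum)
  also have "\<dots> = code_expect n M (\<lambda>cb. (1 / real M) * (\<Sum>m<M. message_error n \<delta> m cb))"
    by (rule indep_expect_cong) (simp add: avg_error_def message_error_def Let_def seqs_def[of M])
  also have "\<dots> = (1 / real M) * (\<Sum>m<M. code_expect n M (message_error n \<delta> m))"
    by (simp only: indep_expect_cmult indep_expect_sum)
  also have "\<dots> \<le> (1 / real M) * (\<Sum>m<M. X)"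
    using assms(2) by (intro mult_left_mono sum_mono) auto
  also have "\<dots> \<le> X" using assms(1) by simp
  finally show ?thesis .
qed

lemma dec_state_vec_if_typical:
  assumes n: "0 < n" and \<delta>: "0 < \<delta>" "\<delta> \<le> 1"
    and zs: "zs \<in> seqs n pairs" "typical pairs (joint p q) (\<delta> / 4) zs"
  shows "dec \<delta> (map fst zs) *\<^sub>v state_vec zs = state_vec zs"
proof -
  note xs = map_fst_snd_mem_seqs(1)[OF zs(1)]
  have set: "set zs \<subseteq> pairs" using zs(1) by (simp add: seqs_def)
  have "typical {0..<k} p (\<delta> / 4) (map fst zs)"
    by (rule typical_map_fst[OF zs(2) set]) (simp add: q_distribution)
  then have "typical {0..<k} p \<delta> (map fst zs)"
    using typical_mono[of "{0..<k}" p "\<delta> / 4" "map fst zs" \<delta>] \<delta>(1) p_distribution by simp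
  moreover have "map snd zs \<in> cond_typical_seqs k d q \<delta> (map fst zs)"
    using cond_typical_if_typical_joint[OF p_distribution q_distribution set \<delta> zs(2)]
      map_fst_snd_mem_seqs[OF zs(1)] by (simp add: cond_typical_seqs_def seqs_def)
  ultimately show ?thesis
    using span_proj_basis[OF finite_cond_typical_seqs orthonormal_on_cond_typical[OF xs],
        of "map snd zs" \<delta>]
    by (simp add: dec_eq[OF xs n] zip_map_fst_snd)
qed

lemma joint_expect_dec_loss_le:
  assumes n: "0 < n" and \<delta>: "0 < \<delta>" "\<delta> \<le> 1"
  shows "joint_expect n (\<lambda>zs. sq_norm (state_vec zs - dec \<delta> (map fst zs) *\<^sub>v state_vec zs))
    \<le> (\<Sum>z\<in>pairs. 1 / ((\<delta> / 4)\<^sup>2 * joint p q z)) / real n"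
proof -
  have "joint_expect n (\<lambda>zs. sq_norm (state_vec zs - dec \<delta> (map fst zs) *\<^sub>v state_vec zs))
    \<le> joint_expect n (\<lambda>zs. of_bool (\<not> typical pairs (joint p q) (\<delta> / 4) zs))"
  proof (rule indep_expect_mono)
    fix zs assume "zs \<in> seqs (length (replicate n (joint p q))) pairs"
    then have zs: "zs \<in> seqs n pairs" by simp
    let ?P = "dec \<delta> (map fst zs)"
    note v = state_vec_unit[OF zs] and P = projection_dec[OF map_fst_snd_mem_seqs(1)[OF zs] n, of \<delta>]
    show "sq_norm (state_vec zs - ?P *\<^sub>v state_vec zs)
        \<le> of_bool (\<not> typical pairs (joint p q) (\<delta> / 4) zs)"
    proof (cases "typical pairs (joint p q) (\<delta> / 4) zs")
      case True
      then show ?thesis using v(1) by (simp add: dec_state_vec_if_typical[OF n \<delta> zs] sq_norm_zero)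
    next
      case False
      then show ?thesis
        using sq_norm_projection_compl[OF P v(1)] sq_norm_nonneg[of "?P *\<^sub>v state_vec zs"] v(2) by simp
    qed
  qed (use joint_distribution in simp)
  also have "\<dots> \<le> (\<Sum>z\<in>pairs. 1 / ((\<delta> / 4)\<^sup>2 * joint p q z)) / real n"
    using \<delta> n by (intro prob_atypical_le[OF joint_distribution]) auto
  finally show ?thesis .
qed

end

locale cq_channel_eigenbasis = cq_channel +
  fixes f :: "nat \<Rightarrow> complex vec" and r :: "nat \<Rightarrow> real"
  assumes f_orthonormal: "orthonormal_on d f {0..<d}"
    and avg_state_eq: "avg_state = mixture d r f {0..<d}"
begin

definition basis_vec :: "nat list \<Rightarrow> complex vec" where
  "basis_vec ts = tensor_vec_list (map f ts)"

definition avg_typical :: "real \<Rightarrow> nat \<Rightarrow> nat list set" where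
  "avg_typical \<delta> n = {ts \<in> seqs n {0..<d}. typical {0..<d} r \<delta> ts}"

definition avg_proj :: "real \<Rightarrow> nat \<Rightarrow> complex mat" where
  "avg_proj \<delta> n = span_proj (d ^ n) basis_vec (avg_typical \<delta> n)"

lemma r_distribution: "distribution {0..<d} r"
proof (rule distribution_eigenvalues[OF f_orthonormal])
  show "0 \<le> Re ((mixture d r f {0..<d} *\<^sub>v v) \<bullet>c v)" if "v \<in> carrier_vec d" for v
    using Re_mixture_cscalar_prod_self[of pairs eigvec d v "joint p q"] eigvec_carrier that
      distributionD(2)[OF joint_distribution]
    by (simp add: sum_nonneg flip: avg_state_def avg_state_eq)
  have "mtrace avg_state = complex_of_real (sum (joint p q) pairs)"
    using mtrace_mixture[of pairs eigvec d "joint p q"] eigvec_carrier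
    by (simp add: avg_state_def sq_norm_eigvec)
  then show "mtrace (mixture d r f {0..<d}) = 1"
    by (simp add: distributionD(3)[OF joint_distribution] flip: avg_state_eq)
qed simp

lemma vn_entropy_avg_state: "vn_entropy avg_state = shannon_entropy {0..<d} r"
  unfolding avg_state_eq by (rule vn_entropy_mixture) (simp_all add: f_orthonormal)

lemma finite_avg_typical: "finite (avg_typical \<delta> n)"
  by (simp add: avg_typical_def finite_seqs)

lemma avg_typical_subset: "avg_typical \<delta> n \<subseteq> seqs n {0..<d}"
  by (auto simp: avg_typical_def)

lemma orthonormal_on_basis_vec: "orthonormal_on (d ^ n) basis_vec (seqs n {0..<d})"
  using orthonormal_on_tensor_power[OF f_orthonormal] by (simp add: basis_vec_def[abs_def])

lemmas orthonormal_on_avg_typical = orthonormal_on_subset[OF orthonormal_on_basis_vec avg_typical_subset]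

lemma projection_avg_proj: "projection (d ^ n) (avg_proj \<delta> n)"
  unfolding avg_proj_def by (rule projection_span_proj[OF finite_avg_typical orthonormal_on_avg_typical])

lemma avg_proj_basis_vec:
  assumes "ts \<in> seqs n {0..<d}"
  shows "avg_proj \<delta> n *\<^sub>v basis_vec ts = (if ts \<in> avg_typical \<delta> n then basis_vec ts else 0\<^sub>v (d ^ n))"
  using span_proj_basis[OF finite_avg_typical orthonormal_on_avg_typical]
    span_proj_orthogonal_basis[OF finite_avg_typical orthonormal_on_basis_vec avg_typical_subset] assms
  by (simp add: avg_proj_def)

lemma joint_expect_state_vec_eq_basis_vec:
  assumes "L \<in> carrier_mat m (d ^ n)"
  shows "joint_expect n (\<lambda>zs. sq_norm (L *\<^sub>v state_vec zs))
    = iid_expect n {0..<d} r (\<lambda>ts. sq_norm (L *\<^sub>v basis_vec ts))"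
  unfolding state_vec_def basis_vec_def
  by (rule iid_expect_sq_norm_eq[OF _ assms eigvec_carrier orthonormal_onD(1)[OF f_orthonormal]])
    (simp flip: avg_state_def avg_state_eq)

lemma joint_expect_avg_proj_loss_le:
  assumes "0 < n" "0 < \<delta>"
  shows "joint_expect n (\<lambda>zs. sq_norm (state_vec zs - avg_proj \<delta> n *\<^sub>v state_vec zs))
    \<le> (\<Sum>t\<in>{0..<d}. 1 / (\<delta>\<^sup>2 * r t)) / real n"
proof -
  let ?L = "1\<^sub>m (d ^ n) - avg_proj \<delta> n"
  note P = projection_carrier[OF projection_avg_proj[of n \<delta>]]
  have "joint_expect n (\<lambda>zs. sq_norm (state_vec zs - avg_proj \<delta> n *\<^sub>v state_vec zs))
      = joint_expect n (\<lambda>zs. sq_norm (?L *\<^sub>v state_vec zs))"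
    by (rule indep_expect_cong) (simp add: projection_compl_vec[OF P state_vec_unit(1)])
  also have "\<dots> = iid_expect n {0..<d} r (\<lambda>ts. sq_norm (?L *\<^sub>v basis_vec ts))"
    by (rule joint_expect_state_vec_eq_basis_vec[OF minus_carrier_mat[OF P]])
  also have "\<dots> = iid_expect n {0..<d} r (\<lambda>ts. of_bool (\<not> typical {0..<d} r \<delta> ts))"
  proof (rule indep_expect_cong)
    fix ts assume "ts \<in> seqs (length (replicate n r)) {0..<d}"
    then have ts: "ts \<in> seqs n {0..<d}" by simp
    note b = orthonormal_onD(1)[OF orthonormal_on_basis_vec ts]
    show "sq_norm (?L *\<^sub>v basis_vec ts) = of_bool (\<not> typical {0..<d} r \<delta> ts)"
      using ts b sq_norm_orthonormal_on[OF orthonormal_on_basis_vec ts]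
      by (simp add: projection_compl_vec[OF P b] avg_proj_basis_vec avg_typical_def sq_norm_zero)
  qed
  also have "\<dots> \<le> (\<Sum>t\<in>{0..<d}. 1 / (\<delta>\<^sup>2 * r t)) / real n"
    by (rule prob_atypical_le[OF r_distribution assms(2,1)])
  finally show ?thesis .
qed

lemma joint_expect_confusion_le:
  assumes ys: "ys \<in> seqs n {0..<k}" and n: "0 < n" and "0 \<le> \<delta>"
  shows "joint_expect n (\<lambda>zs. sq_norm (dec \<delta> ys *\<^sub>v (avg_proj \<delta> n *\<^sub>v state_vec zs)))
    \<le> 2 powr (- (real n * (1 - \<delta>) * vn_entropy avg_state))
      * 2 powr (real n * (1 + \<delta>)\<^sup>2 * output_cond_entropy)"
    (is "_ \<le> ?l * ?K")
proof -
  let ?P = "dec \<delta> ys" and ?\<Pi> = "avg_proj \<delta> n" and ?T = "avg_typical \<delta> n"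
  note P = projection_carrier[OF projection_dec[OF ys n, of \<delta>]]
    and \<Pi> = projection_carrier[OF projection_avg_proj[of n \<delta>]]
  have "joint_expect n (\<lambda>zs. sq_norm (?P *\<^sub>v (?\<Pi> *\<^sub>v state_vec zs)))
      = joint_expect n (\<lambda>zs. sq_norm ((?P * ?\<Pi>) *\<^sub>v state_vec zs))"
    by (rule indep_expect_cong) (simp add: assoc_mult_mat_vec[OF P \<Pi> state_vec_unit(1)])
  also have "\<dots> = iid_expect n {0..<d} r (\<lambda>ts. sq_norm ((?P * ?\<Pi>) *\<^sub>v basis_vec ts))"
    by (rule joint_expect_state_vec_eq_basis_vec[OF mult_carrier_mat[OF P \<Pi>]])
  also have "\<dots> = (\<Sum>ts\<in>?T. prod_list (map r ts) * sq_norm (?P *\<^sub>v basis_vec ts))"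
    unfolding iid_expect_eq_sum
  proof (rule sum.mono_neutral_cong_right)
    show "finite (seqs n {0..<d})" by (simp add: finite_seqs)
    show "?T \<subseteq> seqs n {0..<d}" by (rule avg_typical_subset)
    have split: "(?P * ?\<Pi>) *\<^sub>v basis_vec ts = ?P *\<^sub>v (?\<Pi> *\<^sub>v basis_vec ts)" if "ts \<in> seqs n {0..<d}"
      for ts
      by (rule assoc_mult_mat_vec[OF P \<Pi> orthonormal_onD(1)[OF orthonormal_on_basis_vec that]])
    have "?P *\<^sub>v 0\<^sub>v (d ^ n) = 0\<^sub>v (d ^ n)" using P by (intro eq_vecI) (auto simp: scalar_prod_def)
    then show "\<forall>ts\<in>seqs n {0..<d} - ?T. prod_list (map r ts) * sq_norm ((?P * ?\<Pi>) *\<^sub>v basis_vec ts) = 0"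
      by (simp add: split avg_proj_basis_vec sq_norm_zero)
    show "prod_list (map r ts) * sq_norm ((?P * ?\<Pi>) *\<^sub>v basis_vec ts)
        = prod_list (map r ts) * sq_norm (?P *\<^sub>v basis_vec ts)" if "ts \<in> ?T" for ts
      using that avg_typical_subset[of \<delta> n] by (auto simp: split avg_proj_basis_vec)
  qed
  also have "\<dots> \<le> (\<Sum>ts\<in>?T. ?l * sq_norm (?P *\<^sub>v basis_vec ts))"
    unfolding vn_entropy_avg_state
    by (intro sum_mono mult_right_mono prob_typical_seq_le[OF r_distribution] sq_norm_nonneg)
      (simp_all add: avg_typical_def)
  also have "\<dots> = ?l * (\<Sum>ts\<in>?T. sq_norm (?P *\<^sub>v basis_vec ts))" by (simp add: sum_distrib_left)
  also have "\<dots> \<le> ?l * ?K"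
    by (intro mult_left_mono sum_sq_norm_dec_le[OF ys n \<open>0 \<le> \<delta>\<close>] finite_avg_typical
        orthonormal_on_avg_typical) simp
  finally show ?thesis .
qed

lemma code_size_mult_powr_le:
  "real (nat \<lfloor>2 powr (real n * R)\<rfloor>) * (2 powr (- (real n * a)) * 2 powr (real n * b))
    \<le> (2 powr (R + b - a)) ^ n" for R a b :: real
proof -
  have "real (nat \<lfloor>2 powr (real n * R)\<rfloor>) * (2 powr (- (real n * a)) * 2 powr (real n * b))
      \<le> 2 powr (real n * R) * (2 powr (- (real n * a)) * 2 powr (real n * b))"
    by (intro mult_right_mono) simp_all
  also have "\<dots> = 2 powr (real n * (R + b - a))"
    by (simp add: algebra_simps flip: powr_add)
  also have "\<dots> = (2 powr (R + b - a)) ^ n"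
    by (simp add: powr_realpow[symmetric] powr_powr mult.commute)
  finally show ?thesis .
qed

lemma expected_error_le_explicit:
  fixes R :: real
  assumes n: "0 < n" and \<delta>: "0 < \<delta>" "\<delta> \<le> 1" and c: "0 < c"
  defines "\<gamma> \<equiv> R + (1 + \<delta>)\<^sup>2 * output_cond_entropy - (1 - \<delta>) * vn_entropy avg_state"
  shows "expected_error k d p \<rho> e q \<delta> n (nat \<lfloor>2 powr (real n * R)\<rfloor>)
    \<le> c + (10 + 1 / c) * (\<Sum>t\<in>{0..<d}. 1 / (\<delta>\<^sup>2 * r t)) / real n + 4 * (2 powr \<gamma>) ^ n
      + 8 * (\<Sum>z\<in>pairs. 1 / ((\<delta> / 4)\<^sup>2 * joint p q z)) / real n"
proof -
  let ?M = "nat \<lfloor>2 powr (real n * R)\<rfloor>"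
  let ?G = "2 powr (- (real n * (1 - \<delta>) * vn_entropy avg_state))
        * 2 powr (real n * (1 + \<delta>)\<^sup>2 * output_cond_entropy)"
  have size: "real ?M * ?G \<le> (2 powr \<gamma>) ^ n"
    using code_size_mult_powr_le[of n R "(1 - \<delta>) * vn_entropy avg_state" "(1 + \<delta>)\<^sup>2 * output_cond_entropy"]
    by (simp only: \<gamma>_def mult.assoc)
  show ?thesis (is "_ \<le> ?X")
  proof (rule expected_error_le_if_message_error_le)
    show "0 \<le> ?X"
      using c distributionD(2)[OF r_distribution] distributionD(2)[OF joint_distribution]
      by (intro add_nonneg_nonneg divide_nonneg_nonneg mult_nonneg_nonneg sum_nonneg) auto
    fix m assume m: "m < ?M"
    have "code_expect n ?M (message_error n \<delta> m)
      \<le> c + (10 + 1 / c) * joint_expect n (\<lambda>zs. sq_norm (state_vec zs - avg_proj \<delta> n *\<^sub>v state_vec zs))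
        + 4 * (real m * ?G)
        + 8 * joint_expect n (\<lambda>zs. sq_norm (state_vec zs - dec \<delta> (map fst zs) *\<^sub>v state_vec zs))"
      using \<delta>(1)
      by (intro code_expect_message_error_le[OF m n projection_avg_proj c] joint_expect_confusion_le[OF _ n])
        auto
    also have "\<dots> \<le> c + (10 + 1 / c) * ((\<Sum>t\<in>{0..<d}. 1 / (\<delta>\<^sup>2 * r t)) / real n)
        + 4 * (2 powr \<gamma>) ^ n + 8 * ((\<Sum>z\<in>pairs. 1 / ((\<delta> / 4)\<^sup>2 * joint p q z)) / real n)"
    proof -
      have "real m * ?G \<le> real ?M * ?G" using m by (intro mult_right_mono) auto
      then have "real m * ?G \<le> (2 powr \<gamma>) ^ n" using size by linarith
      then show ?thesis
        using c
        by (intro add_mono mult_left_mono order_refl joint_expect_avg_proj_loss_le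
            joint_expect_dec_loss_le n \<delta>) auto
    qed
    finally show "code_expect n ?M (message_error n \<delta> m) \<le> ?X" by simp
  qed
qed

theorem expected_error_eventually_le:
  assumes rate: "R < vn_entropy avg_state - output_cond_entropy"
  shows "\<exists>\<delta>. 0 < \<delta> \<and> \<delta> < 1 / 64 \<and>
    (\<forall>\<eta>>0. \<forall>\<^sub>F n in sequentially. expected_error k d p \<rho> e q \<delta> n (nat \<lfloor>2 powr (real n * R)\<rfloor>) \<le> \<eta>)"
proof -
  define \<gamma> where "\<gamma> \<delta> = R + (1 + \<delta>)\<^sup>2 * output_cond_entropy - (1 - \<delta>) * vn_entropy avg_state" for \<delta>
  have "(\<gamma> \<longlongrightarrow> \<gamma> 0) (at_right 0)" unfolding \<gamma>_def by (intro tendsto_intros)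
  moreover have "\<gamma> 0 < 0" using rate by (simp add: \<gamma>_def)
  ultimately have "\<forall>\<^sub>F \<delta> in at_right 0. \<gamma> \<delta> < 0" by (rule order_tendstoD(2))
  moreover have "\<forall>\<^sub>F \<delta> in at_right 0. \<delta> \<in> {0<..<1 / 64 :: real}" by (rule eventually_at_right_real) simp
  ultimately have "\<forall>\<^sub>F \<delta> in at_right 0. \<gamma> \<delta> < 0 \<and> \<delta> \<in> {0<..<1 / 64}" by (rule eventually_conj)
  then obtain \<delta> where \<delta>: "\<gamma> \<delta> < 0" "0 < \<delta>" "\<delta> < 1 / 64"
    using eventually_happens'[OF trivial_limit_at_right_real] by fastforce
  have "\<forall>\<^sub>F n in sequentially. expected_error k d p \<rho> e q \<delta> n (nat \<lfloor>2 powr (real n * R)\<rfloor>) \<le> \<eta>"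
    if \<eta>: "0 < \<eta>" for \<eta>
  proof -
    define c where "c = \<eta> / 2"
    define C1 where "C1 = (10 + 1 / c) * (\<Sum>t\<in>{0..<d}. 1 / (\<delta>\<^sup>2 * r t))"
    define C2 where "C2 = 8 * (\<Sum>z\<in>pairs. 1 / ((\<delta> / 4)\<^sup>2 * joint p q z))"
    have "(\<lambda>n. c + C1 / real n + 4 * (2 powr \<gamma> \<delta>) ^ n + C2 / real n) \<longlonglongrightarrow> c + 0 + 4 * 0 + 0"
      using \<delta>(1) by (intro tendsto_add tendsto_mult tendsto_const lim_const_over_n LIMSEQ_realpow_zero)
        (simp_all add: powr_less_one)
    then have "\<forall>\<^sub>F n in sequentially. c + C1 / real n + 4 * (2 powr \<gamma> \<delta>) ^ n + C2 / real n < \<eta>"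
      by (rule order_tendstoD(2)) (use \<eta> in \<open>simp add: c_def\<close>)
    then show ?thesis
      using eventually_gt_at_top[of 0]
    proof eventually_elim
      case (elim n)
      then show ?case
        using expected_error_le_explicit[of n \<delta> c R] \<delta> \<eta> by (simp add: c_def C1_def C2_def \<gamma>_def)
    qed
  qed
  then show ?thesis using \<delta> by blast
qed

end

theorem theorem1:
  fixes k d :: nat and p :: "nat \<Rightarrow> real" and \<rho> :: "nat \<Rightarrow> complex mat"
    and e :: "nat \<Rightarrow> nat \<Rightarrow> complex vec" and q :: "nat \<Rightarrow> nat \<Rightarrow> real"
    and R \<eta> :: real
  assumes d_pos: "d > 0"
    and p_nonneg: "\<forall>x<k. p x \<ge> 0" and p_sum: "(\<Sum>x<k. p x) = 1"
    and rho_carrier: "\<forall>x<k. \<rho> x \<in> carrier_mat d d"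
    and rho_herm: "\<forall>x<k. mat_adjoint (\<rho> x) = \<rho> x"
    and rho_pos: "\<forall>x<k. \<forall>v \<in> carrier_vec d. Re ((\<rho> x *\<^sub>v v) \<bullet>c v) \<ge> 0"
    and rho_tr: "\<forall>x<k. mtrace (\<rho> x) = 1"
    and e_carrier: "\<forall>x<k. \<forall>s<d. e x s \<in> carrier_vec d"
    and e_orthonormal: "\<forall>x<k. \<forall>s<d. \<forall>t<d. e x s \<bullet>c e x t = (if s = t then 1 else 0)"
    and eig_decomp: "\<forall>x<k. \<rho> x = sum_matrix d (\<lambda>s. complex_of_real (q x s) \<cdot>\<^sub>m outer (e x s)) {0..<d}"
    and rate: "R < mutual_info k d (cq_state k d p \<rho>)"
    and eta: "\<eta> > 0"
  shows "\<exists>\<delta> n. 0 < \<delta> \<and> \<delta> < 1/64 \<and> 0 < n \<and>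
           expected_error k d p \<rho> e q \<delta> n (nat \<lfloor>2 powr (real n * R)\<rfloor>) \<le> \<eta>"
proof -
  have e: "orthonormal_on d (e x) {0..<d}" if "x < k" for x
    using e_carrier e_orthonormal that by (simp add: orthonormal_on_def)
  have rho: "\<rho> x = mixture d (q x) (e x) {0..<d}" if "x < k" for x
    using eig_decomp that by (simp add: mixture_def)
  have q: "distribution {0..<d} (q x)" if "x < k" for x
    using distribution_eigenvalues[OF e] rho rho_pos rho_tr that by simp
  have "distribution {0..<k} p" using p_nonneg p_sum by (simp add: distribution_def atLeast0LessThan)
  then interpret cq_channel k d p \<rho> e q using e rho q by unfold_locales
  obtain f r where "orthonormal_on d f {0..<d}" "avg_state = mixture d r f {0..<d}"
    by (rule avg_state_spectral_decomposition)
  then interpret cq_channel_eigenbasis k d p \<rho> e q f r by unfold_locales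
  obtain \<delta> where \<delta>: "0 < \<delta>" "\<delta> < 1 / 64"
    and "\<forall>\<^sub>F n in sequentially. expected_error k d p \<rho> e q \<delta> n (nat \<lfloor>2 powr (real n * R)\<rfloor>) \<le> \<eta>"
    using expected_error_eventually_le[of R] rate eta unfolding mutual_info_cq_state by blast
  then have "\<forall>\<^sub>F n in sequentially.
      expected_error k d p \<rho> e q \<delta> n (nat \<lfloor>2 powr (real n * R)\<rfloor>) \<le> \<eta> \<and> 0 < n"
    using eventually_gt_at_top[of 0] by (intro eventually_conj)
  then show ?thesis using \<delta> eventually_happens'[OF sequentially_bot] by fastforce
qed

end
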